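(* Let $G$ be a finitely generated group and $K$ a subgroup of $G$. (a) The pair $(G,K)$ is context-free if and only if for any symmetric semigroup presentation $\psi:\Sigma\to G$, the Schreier graph $X(G,K,\psi)$ is a context-free graph (with respect to its root $o=K$). In this case, the language $L(G,K,\psi)$ is deterministic context-free for every (not necessarily symmetric) semigroup presentation $\psi:\Sigma\to G$. (b) If $(G,K)$ is context-free, then $(G,g^{-1}Kg)$ is also context-free for every $g\in G$.
   Context: **Pairs of groups.** A *semigroup presentation* of a finitely generated group $G$ is a (not necessarily injective) map $\psi:\Sigma\to G$ from a finite alphabet $\Sigma$ such that its extension to a monoid homomorphism $\psi:\Sigma^*\to G$ is surjective. It is *symmetric* if there is an involution $a\mapsto a^{-1}$ of $\Sigma$ with $a^{-1}\ne a$ for all $a$, such that $\psi(a^{-1})=\psi(a)^{-1}$. For a subgroup $K\le G$ (not necessarily finitely generated), $L(G,K,\psi)=\{w\in\Sigma^*:\psi(w)\in K\}$. The pair $(G,K)$ is *context-free* if $L(G,K,\psi)$ is a context-free language for some (equivalently, every) semigroup presentation $\psi$ of $G$. **Schreier graph.** $X(G,K,\psi)$ is the labelled directed graph with vertex set $K\backslash G=\{Kg:g\in G\}$, root $o=K$, and edges $(Kg,a,Kg\psi(a))$ with label $a$, for $g\in G$, $a\in\Sigma$. **Context-free graphs.** Let $X$ be a connected symmetric labelled graph with root $o$ (symmetric: for each edge $(x,a,y)$ also $(y,a^{-1},x)$ is an edge), with graph metric $d$ = minimal length of paths. The *cones* with respect to $o$ are the connected components of the induced graphs $X\setminus\{x:d(x,o)\le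 n\}$, $n\ge 0$. The boundary $\partial C$ of a cone $C$ is the set of vertices of $C$ having a neighbour outside $C$. $X$ is *context-free* (with respect to $o$) if there are only finitely many isomorphism types of cones as labelled graphs with boundary (an isomorphism is a bijection of vertex sets $C\to C'$ preserving labelled edges in both directions and mapping $\partial C$ onto $\partial C'$). **Deterministic context-free languages.** A pushdown automaton is $(Q,\Sigma,Z,\delta,q_0,Q_f,z_0)$ with finite sets $Q$ (states), $\Sigma$ (input alphabet), $Z$ (stack symbols), $q_0\in Q$, $Q_f\subset Q$, $z_0\in Z$, and $\delta$ a map from $Q\times(\Sigma\cup\{\epsilon\})\times(Z\cup\{\epsilon\})$ to the finite subsets of $Q\times Z^*$, $\epsilon$ being the empty word. In state $p$, with top (rightmost) stack symbol $z$ (or $z=\epsilon$ if the stack is empty), it may choose $(q,\zeta')\in\delta(p,a,z)$, where $a$ is the next input letter, consume $a$, go to state $q$ and replace $z$ by $\zeta'$; or choose $(q,\zeta')\in\delta(p,\epsilon,z)$ and do the same without consuming input. A word is accepted if, starting in state $q_0$ with stack $z_0$, the automaton can reach after finitely many transitions a final state (in $Q_f$) with empty stack and with all input consumed. It is deterministic if $|\delta(p,a,z)|+|\delta(p,\epsilon,z)|\le 1$ for all $p\in Q$, $a\in\Sigma$, $z\in Z\cup\{\epsilon\}$. A language is context-free iff it is accepted by some pushdown automaton; a context-free language is *deterministic* if it is accepted by some deterministic pushdown automaton. *)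

theory Defs
  imports "HOL-Algebra.Coset" "HOL-Algebra.Generated_Groups"
begin

section \<open>Pushdown automata and context-free languages\<close>

text \<open>In the transition map, the input letter \<open>None\<close> and the stack symbol \<open>None\<close> stand for the
  empty word; a stack is a list whose top is its last element.\<close>

record ('q, 'a, 'z) pda =
  pda_states :: "'q set"
  pda_alphabet :: "'a set"
  pda_stack_symbols :: "'z set"
  pda_trans :: "'q \<Rightarrow> 'a option \<Rightarrow> 'z option \<Rightarrow> ('q \<times> 'z list) set"
  pda_start :: 'q
  pda_final :: "'q set"
  pda_start_symbol :: 'z

definition pda :: "('q, 'a, 'z) pda \<Rightarrow> bool" where
  "pda M \<longleftrightarrow>
     finite (pda_states M) \<and> finite (pda_alphabet M) \<and> finite (pda_stack_symbols M) \<and>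
     (\<forall>p \<in> pda_states M. \<forall>a \<in> insert None (Some ` pda_alphabet M).
        \<forall>z \<in> insert None (Some ` pda_stack_symbols M).
          finite (pda_trans M p a z) \<and>
          pda_trans M p a z \<subseteq> pda_states M \<times> lists (pda_stack_symbols M)) \<and>
     pda_start M \<in> pda_states M \<and> pda_final M \<subseteq> pda_states M \<and>
     pda_start_symbol M \<in> pda_stack_symbols M"

definition deterministic_pda :: "('q, 'a, 'z) pda \<Rightarrow> bool" where
  "deterministic_pda M \<longleftrightarrow> pda M \<and>
     (\<forall>p \<in> pda_states M. \<forall>a \<in> pda_alphabet M.
        \<forall>z \<in> insert None (Some ` pda_stack_symbols M).
          card (pda_trans M p (Some a) z) + card (pda_trans M p None z) \<le> 1)"

definition stack_top :: "'z list \<Rightarrow> 'z option" where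
  "stack_top s = (if s = [] then None else Some (last s))"

text \<open>Configurations are triples (state, remaining input, stack). Since \<open>butlast [] = []\<close>, the
  replacement of the top symbol also covers the empty stack.\<close>

inductive pda_step ::
    "('q, 'a, 'z) pda \<Rightarrow> 'q \<times> 'a list \<times> 'z list \<Rightarrow> 'q \<times> 'a list \<times> 'z list \<Rightarrow> bool"
  for M where
  read: "(q, u) \<in> pda_trans M p (Some a) (stack_top s) \<Longrightarrow>
           pda_step M (p, a # w, s) (q, w, butlast s @ u)"
| silent: "(q, u) \<in> pda_trans M p None (stack_top s) \<Longrightarrow>
           pda_step M (p, w, s) (q, w, butlast s @ u)"

definition pda_language :: "('q, 'a, 'z) pda \<Rightarrow> 'a list set" where
  "pda_language M = {w \<in> lists (pda_alphabet M).
     \<exists>q \<in> pda_final M. (pda_step M)\<^sup>*\<^sup>* (pda_start M, w, [pda_start_symbol M]) (q, [], [])}"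

text \<open>States and stack symbols form finite sets, so up to renaming they may be taken to be natural
  numbers.\<close>

definition context_free_language :: "'a set \<Rightarrow> 'a list set \<Rightarrow> bool" where
  "context_free_language S L \<longleftrightarrow>
     (\<exists>M :: (nat, 'a, nat) pda. pda M \<and> pda_alphabet M = S \<and> pda_language M = L)"

definition deterministic_context_free_language :: "'a set \<Rightarrow> 'a list set \<Rightarrow> bool" where
  "deterministic_context_free_language S L \<longleftrightarrow>
     (\<exists>M :: (nat, 'a, nat) pda.
        deterministic_pda M \<and> pda_alphabet M = S \<and> pda_language M = L)"


section \<open>Presentations and pairs of groups\<close>

definition finitely_generated_group :: "('g, 'm) monoid_scheme \<Rightarrow> bool" where
  "finitely_generated_group G \<longleftrightarrow>
     group G \<and> (\<exists>A. finite A \<and> A \<subseteq> carrier G \<and> generate G A = carrier G)"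

definition word_value :: "('g, 'm) monoid_scheme \<Rightarrow> ('a \<Rightarrow> 'g) \<Rightarrow> 'a list \<Rightarrow> 'g" where
  "word_value G \<psi> w = foldr (\<lambda>a x. \<psi> a \<otimes>\<^bsub>G\<^esub> x) w \<one>\<^bsub>G\<^esub>"

definition semigroup_presentation ::
    "('g, 'm) monoid_scheme \<Rightarrow> 'a set \<Rightarrow> ('a \<Rightarrow> 'g) \<Rightarrow> bool" where
  "semigroup_presentation G S \<psi> \<longleftrightarrow>
     finite S \<and> \<psi> \<in> S \<rightarrow> carrier G \<and> word_value G \<psi> ` lists S = carrier G"

definition fixpoint_free_involution :: "'a set \<Rightarrow> ('a \<Rightarrow> 'a) \<Rightarrow> bool" where
  "fixpoint_free_involution S \<iota> \<longleftrightarrow> (\<forall>a \<in> S. \<iota> a \<in> S \<and> \<iota> (\<iota> a) = a \<and> \<iota> a \<noteq> a)"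

definition symmetric_presentation ::
    "('g, 'm) monoid_scheme \<Rightarrow> 'a set \<Rightarrow> ('a \<Rightarrow> 'a) \<Rightarrow> ('a \<Rightarrow> 'g) \<Rightarrow> bool" where
  "symmetric_presentation G S \<iota> \<psi> \<longleftrightarrow>
     semigroup_presentation G S \<psi> \<and> fixpoint_free_involution S \<iota> \<and>
     (\<forall>a \<in> S. \<psi> (\<iota> a) = inv\<^bsub>G\<^esub> (\<psi> a))"

definition pair_language ::
    "('g, 'm) monoid_scheme \<Rightarrow> 'g set \<Rightarrow> 'a set \<Rightarrow> ('a \<Rightarrow> 'g) \<Rightarrow> 'a list set" where
  "pair_language G K S \<psi> = {w \<in> lists S. word_value G \<psi> w \<in> K}"

text \<open>As alphabets are finite, alphabets consisting of natural numbers suffice.\<close>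

definition context_free_pair :: "('g, 'm) monoid_scheme \<Rightarrow> 'g set \<Rightarrow> bool" where
  "context_free_pair G K \<longleftrightarrow>
     (\<exists>(S :: nat set) \<psi>. semigroup_presentation G S \<psi> \<and>
        context_free_language S (pair_language G K S \<psi>))"


section \<open>Context-free graphs\<close>

record ('v, 'a) labelled_graph =
  graph_verts :: "'v set"
  graph_labels :: "'a set"
  graph_edges :: "('v \<times> 'a \<times> 'v) set"
  graph_root :: 'v

definition labelled_graph :: "('v, 'a) labelled_graph \<Rightarrow> bool" where
  "labelled_graph X \<longleftrightarrow>
     finite (graph_labels X) \<and>
     graph_edges X \<subseteq> graph_verts X \<times> graph_labels X \<times> graph_verts X \<and>
     graph_root X \<in> graph_verts X"

definition symmetric_graph :: "('a \<Rightarrow> 'a) \<Rightarrow> ('v, 'a) labelled_graph \<Rightarrow> bool" where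
  "symmetric_graph \<iota> X \<longleftrightarrow>
     labelled_graph X \<and> fixpoint_free_involution (graph_labels X) \<iota> \<and>
     (\<forall>x a y. (x, a, y) \<in> graph_edges X \<longrightarrow> (y, \<iota> a, x) \<in> graph_edges X)"

definition adjacent :: "('v, 'a) labelled_graph \<Rightarrow> ('v \<times> 'v) set" where
  "adjacent X = {(x, y). \<exists>a. (x, a, y) \<in> graph_edges X}"

text \<open>The notions below are only used for symmetric graphs, where \<open>adjacent\<close> is a symmetric
  relation, so that directed and undirected paths connect the same vertices.\<close>

definition connected_graph :: "('v, 'a) labelled_graph \<Rightarrow> bool" where
  "connected_graph X \<longleftrightarrow> (\<forall>x \<in> graph_verts X. \<forall>y \<in> graph_verts X. (x, y) \<in> (adjacent X)\<^sup>*)"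

definition graph_dist :: "('v, 'a) labelled_graph \<Rightarrow> 'v \<Rightarrow> 'v \<Rightarrow> nat" where
  "graph_dist X x y = (LEAST n. (x, y) \<in> adjacent X ^^ n)"

definition induced_components :: "('v, 'a) labelled_graph \<Rightarrow> 'v set \<Rightarrow> 'v set set" where
  "induced_components X U = {{y. (x, y) \<in> (adjacent X \<inter> U \<times> U)\<^sup>*} | x. x \<in> U}"

definition cones :: "('v, 'a) labelled_graph \<Rightarrow> 'v set set" where
  "cones X = (\<Union>n. induced_components X (graph_verts X - {x. graph_dist X x (graph_root X) \<le> n}))"

definition cone_boundary :: "('v, 'a) labelled_graph \<Rightarrow> 'v set \<Rightarrow> 'v set" where
  "cone_boundary X C = {x \<in> C. \<exists>y. y \<notin> C \<and> (x, y) \<in> adjacent X}"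

definition cone_iso :: "('v, 'a) labelled_graph \<Rightarrow> 'v set \<Rightarrow> 'v set \<Rightarrow> bool" where
  "cone_iso X C D \<longleftrightarrow>
     (\<exists>f. bij_betw f C D \<and>
        (\<forall>x \<in> C. \<forall>y \<in> C. \<forall>a. (x, a, y) \<in> graph_edges X \<longleftrightarrow> (f x, a, f y) \<in> graph_edges X) \<and>
        f ` cone_boundary X C = cone_boundary X D)"

definition context_free_graph :: "('a \<Rightarrow> 'a) \<Rightarrow> ('v, 'a) labelled_graph \<Rightarrow> bool" where
  "context_free_graph \<iota> X \<longleftrightarrow>
     symmetric_graph \<iota> X \<and> connected_graph X \<and>
     finite (cones X // {(C, D). C \<in> cones X \<and> D \<in> cones X \<and> cone_iso X C D})"

definition schreier_graph ::
    "('g, 'm) monoid_scheme \<Rightarrow> 'g set \<Rightarrow> 'a set \<Rightarrow> ('a \<Rightarrow> 'g) \<Rightarrow> ('g set, 'a) labelled_graph" where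
  "schreier_graph G K S \<psi> =
     \<lparr> graph_verts = rcosets\<^bsub>G\<^esub> K,
       graph_labels = S,
       graph_edges = {(K #>\<^bsub>G\<^esub> g, a, K #>\<^bsub>G\<^esub> (g \<otimes>\<^bsub>G\<^esub> \<psi> a)) | g a. g \<in> carrier G \<and> a \<in> S},
       graph_root = K \<rparr>"

end

theory Submission
  imports Defs
begin

text \<open>If the words labelling loops at one vertex form a context-free language, then a loop
  through the root and a cone is cut up by a derivation tree as a polygon by diagonals, and each
  diagonal is a pair of vertices joined by every word of one of finitely many languages. Let \<open>w\<close>
  label a path inside a cone between boundary vertices \<open>x\<close> and \<open>y\<close>, and close it up by geodesics to
  the root. The maximal subwords of \<open>w\<close> that the tree generates are separated by ends of diagonals
  that lead to these geodesics, hence by vertices at bounded distance from \<open>x\<close> or from \<open>y\<close>. As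
  consecutive ones are joined by a diagonal, \<open>x\<close> and \<open>y\<close> are themselves close. So it depends only on
  a ball around \<open>x\<close>, together with the languages joining its vertices, which words label paths in
  the cone from \<open>x\<close> and which of these end at the same vertex; this is finite information and fixes
  the cone up to isomorphism. Changing the generators or conjugating the subgroup only moves the
  sides of the polygon by a bounded amount.

  Conversely, if there are finitely many types of cones, a deterministic pushdown automaton can
  keep the nested sequence of cones around the current vertex on its stack.\<close>

section \<open>Decomposition of context-free languages\<close>

text \<open>The derivation tree enters only through inclusions \<open>B C \<subseteq> A\<close>
  between finitely many languages, one for each cut of a word; no grammar is built. Such an
  inclusion gives a diagonal because every word acts injectively on the cosets: if all words of
  \<open>A\<close> join x to y, cancelling a fixed word of \<open>C\<close> shows that all words of
  \<open>B\<close> lead from x to one and the same vertex. The loops are based at an arbitrary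
  vertex, which need not be the root that defines the cones. This yields (b): under right
  multiplication K is the stabilizer of the vertex g^-1 K of the Schreier graph of g^-1 K g, so one
  theorem gives context-free graphs for all conjugates, and the automaton turns graphs back into
  languages. As that automaton is deterministic, the claim on deterministic languages comes out of
  the same round trip. The obstacle for the automaton is finiteness: there may be infinitely many
  cones, and each may be infinite. It therefore computes inside one representative per type and
  remembers only boundary vertices and the cones that can be entered from them in one step.\<close>

text \<open>The index counts the moves, so that empty factors can be discarded in a well-founded way.
  Stacks are written with the top first here.\<close>

inductive pops ::
    "('q \<Rightarrow> 'z \<Rightarrow> 'a list \<Rightarrow> 'q \<Rightarrow> 'z list \<Rightarrow> bool) \<Rightarrow> nat \<Rightarrow> 'q \<Rightarrow> 'z list \<Rightarrow> 'a list \<Rightarrow> 'q \<Rightarrow> bool"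
  for mv where
  nil: "pops mv 0 p [] [] p"
| step: "mv p z x q u \<Longrightarrow> pops mv n q (u @ s) w r \<Longrightarrow> pops mv (Suc n) p (z # s) (x @ w) r"

inductive_cases pops_NilE: "pops mv n p [] w r"

lemma pops_append:
  assumes "pops mv n p s v q" "pops mv m q t w r"
  shows "pops mv (n + m) p (s @ t) (v @ w) r"
  using assms by (induction rule: pops.induct) (auto intro: pops.step)

text \<open>Cut the run at the first moment at which \<open>s\<close> is used up; no earlier move
  can have touched \<open>t\<close>.\<close>

lemma pops_appendE:
  assumes "pops mv n p (s @ t) w r"
  obtains n1 n2 w1 w2 q where "n = n1 + n2" "w = w1 @ w2" "pops mv n1 p s w1 q" "pops mv n2 q t w2 r"
proof -
  have "\<exists>n1 n2 w1 w2 q. n = n1 + n2 \<and> w = w1 @ w2 \<and> pops mv n1 p s w1 q \<and> pops mv n2 q t w2 r"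
    using assms
  proof (induction n p "s @ t" w r arbitrary: s rule: pops.induct)
    case (nil p)
    then show ?case by (auto intro: pops.nil)
  next
    case (step p z x q u n s' w r)
    show ?case
    proof (cases s)
      case Nil
      then have "pops mv (Suc n) p t (x @ w) r" using step by (auto intro: pops.step)
      then show ?thesis using Nil by (metis add_0 append_Nil pops.nil)
    next
      case (Cons z' s'')
      then have e: "z' = z" "s' = s'' @ t" using step.hyps(4) by auto
      then have "u @ s' = (u @ s'') @ t" by simp
      from step.hyps(3)[OF this] obtain n1 n2 w1 w2 q'
        where *: "n = n1 + n2" "w = w1 @ w2" "pops mv n1 q (u @ s'') w1 q'" "pops mv n2 q' t w2 r"
        by blast
      have "pops mv (Suc n1) p (z # s'') (x @ w1) q'" using step.hyps(1) *(3) by (rule pops.step)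
      moreover have "Suc n = Suc n1 + n2" "x @ w = (x @ w1) @ w2" using * by auto
      ultimately show ?thesis using *(4) Cons e by blast
    qed
  qed
  then show thesis using that by blast
qed

text \<open>These are the languages of the variables in the usual passage from automata to grammars,
  except that a variable carries a whole stack word instead of a single symbol.\<close>

definition pops_language ::
    "('q \<Rightarrow> 'z \<Rightarrow> 'a list \<Rightarrow> 'q \<Rightarrow> 'z list \<Rightarrow> bool) \<Rightarrow> 'q \<Rightarrow> 'z list \<Rightarrow> 'q \<Rightarrow> 'a list set" where
  "pops_language mv p s q = {w. \<exists>n. pops mv n p s w q}"

lemma pops_language_append:
  "v \<in> pops_language mv p s q \<Longrightarrow> w \<in> pops_language mv q t r \<Longrightarrow> v @ w \<in> pops_language mv p (s @ t) r"
  unfolding pops_language_def by (blast intro: pops_append)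

lemma pops_language_step:
  "mv p z x q u \<Longrightarrow> w \<in> pops_language mv q u r \<Longrightarrow> x @ w \<in> pops_language mv p [z] r"
  unfolding pops_language_def using pops.step[of mv p z x q u _ "[]"] by auto

text \<open>This replaces a production A -> BC. The factor languages may depend on the word, but
  their full product has to lie in \<open>A\<close>; that is what later makes all words of
  \<open>B\<close> interchangeable. Nonempty factors allow induction on the length.\<close>

definition splits_in :: "'a list set set \<Rightarrow> 'a list set \<Rightarrow> 'a list \<Rightarrow> bool" where
  "splits_in F A w \<longleftrightarrow> (\<exists>b c. w = b @ c \<and> b \<noteq> [] \<and> c \<noteq> [] \<and>
     (\<exists>B \<in> F. \<exists>C \<in> F. b \<in> B \<and> c \<in> C \<and> (\<forall>b' \<in> B. \<forall>c' \<in> C. b' @ c' \<in> A)))"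

text \<open>A semantic substitute for Chomsky normal form: the family plays the role of the languages
  generated by the variables of a grammar.\<close>

definition splitting_family :: "'a set \<Rightarrow> 'a list set set \<Rightarrow> bool" where
  "splitting_family S F \<longleftrightarrow> finite F \<and> F \<subseteq> Pow (lists S) \<and>
     (\<forall>A \<in> F. \<forall>w \<in> A. 2 \<le> length w \<longrightarrow> splits_in F A w)"

lemma splits_inI:
  "w = b @ c \<Longrightarrow> b \<noteq> [] \<Longrightarrow> c \<noteq> [] \<Longrightarrow> B \<in> F \<Longrightarrow> C \<in> F \<Longrightarrow> b \<in> B \<Longrightarrow> c \<in> C \<Longrightarrow>
   (\<And>b' c'. b' \<in> B \<Longrightarrow> c' \<in> C \<Longrightarrow> b' @ c' \<in> A) \<Longrightarrow> splits_in F A w"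
  unfolding splits_in_def by blast

lemma splits_in_mono:
  assumes "splits_in F A w" "A \<subseteq> A'" "F \<subseteq> F'"
  shows "splits_in F' A' w"
proof -
  obtain b c B C where "w = b @ c" "b \<noteq> []" "c \<noteq> []" "B \<in> F" "C \<in> F" "b \<in> B" "c \<in> C"
    and "\<And>b' c'. b' \<in> B \<Longrightarrow> c' \<in> C \<Longrightarrow> b' @ c' \<in> A"
    using assms(1) unfolding splits_in_def by blast
  then show ?thesis using assms(2,3) by (intro splits_inI[of w b c B F' C A']) auto
qed

lemma pops_state: "pops mv n p s w r \<Longrightarrow> p \<in> Q \<Longrightarrow> (\<And>p z x q u. mv p z x q u \<Longrightarrow> q \<in> Q) \<Longrightarrow> r \<in> Q"
  by (induction rule: pops.induct) auto

text \<open>A stack word of several symbols is cut where its first symbol has been popped, a single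
  symbol after the first letter read, which is why the languages \<open>{[a]}\<close> are included.
  If a factor is the empty word, the other factor is all of \<open>w\<close> and takes fewer moves,
  and its language lies in the original one, because the discarded factor can be put back in front
  or behind.\<close>

lemma pops_splits:
  fixes mv :: "'q \<Rightarrow> 'z \<Rightarrow> 'a list \<Rightarrow> 'q \<Rightarrow> 'z list \<Rightarrow> bool" and Q T S
  defines "F \<equiv> {pops_language mv p s q | p s q. p \<in> Q \<and> s \<in> T \<and> q \<in> Q} \<union> {{[a]} | a. a \<in> S}"
  assumes mv: "\<And>p z x q u. mv p z x q u \<Longrightarrow> q \<in> Q \<and> u \<in> T \<and> [z] \<in> T \<and> (x = [] \<or> (\<exists>a \<in> S. x = [a]))"
    and T: "\<And>z s. z # s \<in> T \<Longrightarrow> s \<in> T"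
    and run: "pops mv n p s w r" "p \<in> Q" "s \<in> T" "2 \<le> length w"
  shows "splits_in F (pops_language mv p s r) w"
  using run
proof (induction n arbitrary: p s w r rule: less_induct)
  case (less n)
  have F: "pops_language mv p s q \<in> F" if "p \<in> Q" "s \<in> T" "q \<in> Q" for p s q
    unfolding F_def using that by blast
  have st: "r \<in> Q" if "pops mv n p s w r" "p \<in> Q" for n p s w r
    using pops_state[OF that] mv by blast
  from less.prems(1) show ?case
  proof cases
    case nil
    then show ?thesis using less.prems(4) by simp
  next
    case (step z x q u m s0 w')
    from step(5) obtain m1 m2 w1 w2 q' where
      *: "m = m1 + m2" "w' = w1 @ w2" "pops mv m1 q u w1 q'" "pops mv m2 q' s0 w2 r"
      by (rule pops_appendE)
    have uT: "q \<in> Q" "u \<in> T" "[z] \<in> T" and x: "x = [] \<or> (\<exists>a \<in> S. x = [a])"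
      using mv[OF step(4)] by auto
    have s0T: "s0 \<in> T" using T less.prems(3) step(2) by blast
    have q': "q' \<in> Q" using st[OF *(3) uT(1)] .
    have rQ: "r \<in> Q" using st[OF *(4) q'] .
    have v: "pops mv (Suc m1) p [z] (x @ w1) q'"
      using pops.step[of mv p z x q u m1 "[]", OF step(4)] *(3) by simp
    show ?thesis
    proof (cases "s0 = []")
      case True
      with *(4) have e: "w2 = []" "q' = r" "m2 = 0" by (auto elim: pops_NilE)
      show ?thesis
      proof (cases "x = []")
        case True
        have "splits_in F (pops_language mv q u r) w"
          using less.IH[of m1 q u w1 r] * e uT less.prems(4) step True by simp
        moreover have "pops_language mv q u r \<subseteq> pops_language mv p s r"
          using pops_language_step[of mv p z x q u _ r, OF step(4)] True \<open>s0 = []\<close> step(2) by auto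
        ultimately show ?thesis using splits_in_mono by blast
      next
        case False
        then obtain a where a: "a \<in> S" "x = [a]" using x by blast
        have "{[a]} \<in> F" unfolding F_def using a by blast
        then show ?thesis
          using a e * step less.prems(4) \<open>s0 = []\<close> F[OF uT(1,2) rQ] pops_language_step[of mv p z x q u _ r, OF step(4)]
          by (intro splits_inI[of w "[a]" w1 "{[a]}" F "pops_language mv q u r"])
            (auto simp: pops_language_def)
      qed
    next
      case False
      \<comment> \<open>Popping a nonempty stack costs a move, so the run on \<open>[z]\<close>
        alone is shorter than the whole run even if \<open>w2\<close> is empty.\<close>
      then have m2: "0 < m2" using *(4) by (auto elim: pops.cases)
      have s: "s = [z] @ s0" using step by simp
      consider "x @ w1 = []" | "w2 = []" | "x @ w1 \<noteq> []" "w2 \<noteq> []" by blast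
      then show ?thesis
      proof cases
        case 1
        have "splits_in F (pops_language mv q' s0 r) w"
          using less.IH[of m2 q' s0 w2 r] * q' s0T less.prems(4) step 1 by simp
        moreover have "pops_language mv q' s0 r \<subseteq> pops_language mv p s r"
          using v pops_language_append[of "[]" mv p "[z]" q' _ s0 r] 1 unfolding s pops_language_def by auto
        ultimately show ?thesis using splits_in_mono by blast
      next
        case 2
        have "splits_in F (pops_language mv p [z] q') w"
          using less.IH[OF _ v less.prems(2) uT(3)] * less.prems(4) step 2 m2 by simp
        moreover have "pops_language mv p [z] q' \<subseteq> pops_language mv p s r"
          using *(4) pops_language_append[of _ mv p "[z]" q' "[]" s0 r] 2 unfolding s pops_language_def by auto
        ultimately show ?thesis using splits_in_mono by blast
      next
        case 3
        then show ?thesis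
          using F[OF less.prems(2) uT(3) q'] F[OF q' s0T rQ] v * step
          unfolding s
          by (intro splits_inI[of w "x @ w1" w2 "pops_language mv p [z] q'" F "pops_language mv q' s0 r"]
              pops_language_append) (auto simp: pops_language_def)
      qed
    qed
  qed
qed

text \<open>A bottom marker, here \<open>None\<close>, turns acceptance with empty stack into popping the whole stack,
  although the automaton may move on an empty stack.\<close>

inductive pda_move ::
    "('q, 'a, 'z) pda \<Rightarrow> 'q \<Rightarrow> 'z option \<Rightarrow> 'a list \<Rightarrow> 'q \<Rightarrow> 'z option list \<Rightarrow> bool" for M where
  read: "p \<in> pda_states M \<Longrightarrow> a \<in> pda_alphabet M \<Longrightarrow> z \<in> insert None (Some ` pda_stack_symbols M) \<Longrightarrow>
    (q, u) \<in> pda_trans M p (Some a) z \<Longrightarrow>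
    pda_move M p z [a] q (map Some (rev u) @ (if z = None then [None] else []))"
| silent: "p \<in> pda_states M \<Longrightarrow> z \<in> insert None (Some ` pda_stack_symbols M) \<Longrightarrow>
    (q, u) \<in> pda_trans M p None z \<Longrightarrow>
    pda_move M p z [] q (map Some (rev u) @ (if z = None then [None] else []))"
| finish: "p \<in> pda_final M \<Longrightarrow> pda_move M p None [] p []"

lemma pda_transD:
  assumes "pda M" "p \<in> pda_states M" "a \<in> insert None (Some ` pda_alphabet M)"
    "z \<in> insert None (Some ` pda_stack_symbols M)" "(q, u) \<in> pda_trans M p a z"
  shows "q \<in> pda_states M" "u \<in> lists (pda_stack_symbols M)"
  using assms unfolding pda_def by blast+

text \<open>The dictionary between the two conventions: top last and possibly empty, or top first
  with the marker at the bottom. A move on the empty stack sees the marker and puts it back.\<close>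

lemma pda_move_top:
  assumes "s \<in> lists (pda_stack_symbols M)"
  obtains z t where "map Some (rev s) @ [None] = z # t" "stack_top s = z"
    "z \<in> insert None (Some ` pda_stack_symbols M)"
    "\<And>u. map Some (rev u) @ (if z = None then [None] else []) @ t = map Some (rev (butlast s @ u)) @ [None]"
proof (cases s rule: rev_cases)
  case Nil
  then show thesis using that[of None "[]"] by (auto simp: stack_top_def)
next
  case (snoc s' z)
  then show thesis using that[of "Some z" "map Some (rev s') @ [None]"] assms by (auto simp: stack_top_def)
qed

lemma pda_run_pops:
  assumes M: "pda M"
    and run: "(pda_step M)\<^sup>*\<^sup>* (p, w, s) (q, [], [])"
    and p: "p \<in> pda_states M" and w: "w \<in> lists (pda_alphabet M)"
    and s: "s \<in> lists (pda_stack_symbols M)" and q: "q \<in> pda_final M"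
  shows "\<exists>n. pops (pda_move M) n p (map Some (rev s) @ [None]) w q"
proof -
  have "\<forall>p w s. c = (p, w, s) \<longrightarrow> p \<in> pda_states M \<longrightarrow> w \<in> lists (pda_alphabet M) \<longrightarrow>
      s \<in> lists (pda_stack_symbols M) \<longrightarrow> (\<exists>n. pops (pda_move M) n p (map Some (rev s) @ [None]) w q)"
    if "(pda_step M)\<^sup>*\<^sup>* c (q, [], [])" for c
    using that
  proof (induction rule: converse_rtranclp_induct)
    case base
    have "pops (pda_move M) (Suc 0) q (None # []) ([] @ []) q"
      by (rule pops.step[where q = q and u = "[]"]) (use q in \<open>auto intro: pda_move.intros pops.nil\<close>)
    then show ?case by auto
  next
    case (step c c')
    show ?case
    proof (intro allI impI)
      fix p w s
      assume c: "c = (p, w, s)" and p: "p \<in> pda_states M" and w: "w \<in> lists (pda_alphabet M)"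
        and s: "s \<in> lists (pda_stack_symbols M)"
      obtain z t where zt: "map Some (rev s) @ [None] = z # t" "stack_top s = z"
        "z \<in> insert None (Some ` pda_stack_symbols M)"
        "\<And>u. map Some (rev u) @ (if z = None then [None] else []) @ t = map Some (rev (butlast s @ u)) @ [None]"
        using pda_move_top[OF s] by blast
      have bs: "butlast s \<in> lists (pda_stack_symbols M)" using s by (auto dest: in_set_butlastD)
      from step(1) c show "\<exists>n. pops (pda_move M) n p (map Some (rev s) @ [None]) w q"
      proof cases
        case (read q' u p' a s' w')
        have d: "a \<in> pda_alphabet M" "w' \<in> lists (pda_alphabet M)" using read c w by auto
        let ?v = "map Some (rev u) @ (if z = None then [None] else [])"
        have m: "pda_move M p z [a] q' ?v"
          using read c p d zt by (intro pda_move.read) auto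
        have "q' \<in> pda_states M" "u \<in> lists (pda_stack_symbols M)"
          using pda_transD[OF M p, of "Some a" z q' u] read c d zt by auto
        then obtain n where "pops (pda_move M) n q' (map Some (rev (butlast s @ u)) @ [None]) w' q"
          using step.IH read c d bs by auto
        then have "pops (pda_move M) (Suc n) p (z # t) ([a] @ w') q"
          using zt(4)[of u] by (intro pops.step[where mv = "pda_move M" and q = q' and u = ?v] m) simp
        then show ?thesis using zt(1) read c by auto
      next
        case (silent q' u p' s' w')
        let ?v = "map Some (rev u) @ (if z = None then [None] else [])"
        have m: "pda_move M p z [] q' ?v"
          using silent c p zt by (intro pda_move.silent) auto
        have "q' \<in> pda_states M" "u \<in> lists (pda_stack_symbols M)"
          using pda_transD[OF M p, of None z q' u] silent c zt by auto
        then obtain n where "pops (pda_move M) n q' (map Some (rev (butlast s @ u)) @ [None]) w q"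
          using step.IH silent c w bs by auto
        then have "pops (pda_move M) (Suc n) p (z # t) ([] @ w) q"
          using zt(4)[of u] by (intro pops.step[where mv = "pda_move M" and q = q' and u = ?v] m) simp
        then show ?thesis using zt(1) silent c by auto
      qed
    qed
  qed
  then show ?thesis using assms by blast
qed

lemma pops_pda_run:
  assumes M: "pda M"
    and run: "pops (pda_move M) n p (map Some (rev s) @ [None]) w q"
    and s: "s \<in> lists (pda_stack_symbols M)"
  shows "(pda_step M)\<^sup>*\<^sup>* (p, w, s) (q, [], []) \<and> q \<in> pda_final M \<and> w \<in> lists (pda_alphabet M)"
  using run s
proof (induction n p "map Some (rev s) @ [None]" w q arbitrary: s rule: pops.induct)
  case (nil p)
  then show ?case by simp
next
  case (step p z x q u n t w r)
  obtain z' t' where zt': "map Some (rev s) @ [None] = z' # t'" "stack_top s = z'"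
    "z' \<in> insert None (Some ` pda_stack_symbols M)"
    "\<And>u. map Some (rev u) @ (if z' = None then [None] else []) @ t' = map Some (rev (butlast s @ u)) @ [None]"
    using pda_move_top[OF step.prems] by blast
  have e: "z' = z" "t' = t" using zt'(1) step.hyps(4) by auto
  note zt = zt'[unfolded e]
  have bs: "butlast s \<in> lists (pda_stack_symbols M)" using step.prems by (auto dest: in_set_butlastD)
  from step.hyps(1) show ?case
  proof cases
    case (read a v)
    have "v \<in> lists (pda_stack_symbols M)"
      using pda_transD[OF M read(3), of "Some a" z q v] read by auto
    then have "(pda_step M)\<^sup>*\<^sup>* (q, w, butlast s @ v) (r, [], []) \<and> r \<in> pda_final M \<and> w \<in> lists (pda_alphabet M)"
      using step.hyps(3)[of "butlast s @ v"] zt(4)[of v] read bs by auto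
    moreover have "pda_step M (p, a # w, s) (q, w, butlast s @ v)"
      using read zt by (intro pda_step.read) auto
    ultimately show ?thesis using read by (auto intro: converse_rtranclp_into_rtranclp)
  next
    case (silent v)
    have "v \<in> lists (pda_stack_symbols M)"
      using pda_transD[OF M silent(3), of None z q v] silent by auto
    then have "(pda_step M)\<^sup>*\<^sup>* (q, w, butlast s @ v) (r, [], []) \<and> r \<in> pda_final M \<and> w \<in> lists (pda_alphabet M)"
      using step.hyps(3)[of "butlast s @ v"] zt(4)[of v] silent bs by auto
    moreover have "pda_step M (p, w, s) (q, w, butlast s @ v)"
      using silent zt by (intro pda_step.silent) auto
    ultimately show ?thesis using silent by (auto intro: converse_rtranclp_into_rtranclp)
  next
    case finish
    have "s = []" "t = []" using zt finish step.hyps(4) by (auto simp: stack_top_def split: if_splits)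
    then show ?thesis using step.hyps(2) finish by (auto elim: pops_NilE)
  qed
qed

lemma context_free_splitting_family:
  assumes "context_free_language S L"
  obtains F where "splitting_family S F" "L \<in> F"
proof -
  obtain M :: "(nat, 'a, nat) pda" where M: "pda M" and S: "pda_alphabet M = S" and L: "pda_language M = L"
    using assms unfolding context_free_language_def by blast
  let ?Q = "pda_states M" and ?Z = "insert None (Some ` pda_stack_symbols M)" and ?mv = "pda_move M"
  define U where "U = (\<Union>p \<in> ?Q. \<Union>a \<in> insert None (Some ` S). \<Union>z \<in> ?Z. snd ` pda_trans M p a z)"
  have U: "u \<in> U" if "p \<in> ?Q" "a \<in> insert None (Some ` S)" "z \<in> ?Z" "(q, u) \<in> pda_trans M p a z" for p a z q u
  proof -
    have "u \<in> snd ` pda_trans M p a z" using that(4) by force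
    then show ?thesis unfolding U_def using that(1-3) by blast
  qed
  have fin: "finite ?Q" "finite S" "finite (pda_stack_symbols M)" using M S unfolding pda_def by auto
  have finU: "finite U"
    unfolding U_def using M S fin by (intro finite_UN_I) (auto simp: pda_def)
  \<comment> \<open>Room for a pushed word followed by the bottom marker and, whatever
    \<open>U\<close> is, for the initial stack of two symbols. Bounding the length, instead of
    listing the words that occur, makes \<open>T\<close> closed under suffixes.\<close>
  define k where "k = Suc (Suc (Max (length ` U)))"
  have k: "Suc (Suc (length u)) \<le> k" if "u \<in> U" for u
    unfolding k_def using finU that by simp
  define T where "T = {s. set s \<subseteq> ?Z \<and> length s \<le> k}"
  have finT: "finite T" unfolding T_def using fin by (intro finite_lists_length_le) auto
  have st: "pda_start M \<in> ?Q" "pda_start_symbol M \<in> pda_stack_symbols M" "pda_final M \<subseteq> ?Q"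
    using M unfolding pda_def by auto
  let ?s = "[Some (pda_start_symbol M), None]"
  have sT: "?s \<in> T" unfolding T_def k_def using st by auto
  have mv: "q \<in> ?Q \<and> u \<in> T \<and> [z] \<in> T \<and> (x = [] \<or> (\<exists>a \<in> S. x = [a]))" if "?mv p z x q u" for p z x q u
    using that
  proof cases
    case (read a v)
    then have "v \<in> U" using U[of p "Some a" z q v] S by simp
    then show ?thesis
      using pda_transD[OF M read(3), of "Some a" z q v] read k[of v] S unfolding T_def by (auto simp: k_def)
  next
    case (silent v)
    then have "v \<in> U" using U[of p None z q v] by simp
    then show ?thesis
      using pda_transD[OF M silent(3), of None z q v] silent k[of v] S unfolding T_def by (auto simp: k_def)
  next
    case finish
    then show ?thesis using st unfolding T_def by (auto simp: k_def)
  qed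
  define F0 where "F0 = {pops_language ?mv p s q | p s q. p \<in> ?Q \<and> s \<in> T \<and> q \<in> ?Q} \<union> {{[a]} | a. a \<in> S}"
  have split: "splits_in F0 (pops_language ?mv p s q) w"
    if w: "w \<in> pops_language ?mv p s q" "p \<in> ?Q" "s \<in> T" "2 \<le> length w" for p s q w
  proof -
    obtain n where n: "pops ?mv n p s w q" using w(1) unfolding pops_language_def by blast
    have T: "s \<in> T" if "z # s \<in> T" for z s using that unfolding T_def by auto
    show ?thesis unfolding F0_def by (rule pops_splits[OF mv T n w(2-4)])
  qed
  have "finite F0"
  proof -
    have "{pops_language ?mv p s q | p s q. p \<in> ?Q \<and> s \<in> T \<and> q \<in> ?Q} =
        (\<lambda>(p, s, q). pops_language ?mv p s q) ` (?Q \<times> T \<times> ?Q)" by force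
    moreover have "{{[a]} | a. a \<in> S} = (\<lambda>a. {[a]}) ` S" by blast
    ultimately show ?thesis unfolding F0_def using fin finT by simp
  qed
  have Lin: "w \<in> L \<longleftrightarrow> (\<exists>q \<in> pda_final M. w \<in> pops_language ?mv (pda_start M) ?s q)" for w
  proof
    assume "w \<in> L"
    then obtain q where q: "w \<in> lists (pda_alphabet M)" "q \<in> pda_final M"
      "(pda_step M)\<^sup>*\<^sup>* (pda_start M, w, [pda_start_symbol M]) (q, [], [])"
      unfolding L[symmetric] pda_language_def by blast
    then show "\<exists>q \<in> pda_final M. w \<in> pops_language ?mv (pda_start M) ?s q"
      using pda_run_pops[OF M q(3) st(1) q(1) _ q(2)] st(2) unfolding pops_language_def by auto
  next
    assume "\<exists>q \<in> pda_final M. w \<in> pops_language ?mv (pda_start M) ?s q"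
    then show "w \<in> L"
      using pops_pda_run[OF M, of _ "pda_start M" "[pda_start_symbol M]" w] st
      unfolding L[symmetric] pda_language_def pops_language_def by auto
  qed
  have lists: "pops_language ?mv p s q \<subseteq> lists S" for p s q
  proof
    fix w assume "w \<in> pops_language ?mv p s q"
    then obtain n where "pops ?mv n p s w q" unfolding pops_language_def by blast
    then show "w \<in> lists S" by (induction rule: pops.induct) (use mv in fastforce)+
  qed
  show thesis
  proof
    \<comment> \<open>\<open>L\<close> is the union of members of \<open>F0\<close> over the final
      states, so a word of \<open>L\<close> splits as a word of one of these members.\<close>
    show "splitting_family S (insert L F0)"
      unfolding splitting_family_def
    proof (intro conjI ballI impI)
      show "finite (insert L F0)" using \<open>finite F0\<close> by simp
      show "insert L F0 \<subseteq> Pow (lists S)"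
        using lists S unfolding F0_def L[symmetric] pda_language_def by (auto dest: lists[THEN subsetD])
      fix A w assume A: "A \<in> insert L F0" and w: "w \<in> A" "2 \<le> length w"
      from A consider "A = L" | p s q where "A = pops_language ?mv p s q" "p \<in> ?Q" "s \<in> T" | a where "A = {[a]}"
        unfolding F0_def by blast
      then show "splits_in (insert L F0) A w"
      proof cases
        case 1
        then obtain q where q: "q \<in> pda_final M" "w \<in> pops_language ?mv (pda_start M) ?s q" using Lin w by blast
        have "splits_in F0 (pops_language ?mv (pda_start M) ?s q) w" using split q st sT w by blast
        then show ?thesis by (rule splits_in_mono) (use 1 Lin q in auto)
      next
        case 2
        then have "splits_in F0 A w" using split w by blast
        then show ?thesis by (rule splits_in_mono) auto
      next
        case 3
        then show ?thesis using w by simp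
      qed
    qed
    show "L \<in> insert L F0" by simp
  qed
qed

section \<open>Cones of complete symmetric graphs\<close>

text \<open>Complete means that each vertex has exactly one outgoing edge for each label, so a word
  and a starting vertex determine a path. Schreier graphs are the intended instance; abstracting
  from cosets keeps the group out of the geometry.\<close>

locale complete_symmetric_graph =
  fixes V :: "'v set" and S :: "'a set" and \<iota> :: "'a \<Rightarrow> 'a" and move :: "'v \<Rightarrow> 'a \<Rightarrow> 'v" and root :: 'v
  assumes finite_S: "finite S"
    and inv_S: "fixpoint_free_involution S \<iota>"
    and root_V: "root \<in> V"
    and move_V: "x \<in> V \<Longrightarrow> a \<in> S \<Longrightarrow> move x a \<in> V"
    and move_inv: "x \<in> V \<Longrightarrow> a \<in> S \<Longrightarrow> move (move x a) (\<iota> a) = x"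
    and reach: "x \<in> V \<Longrightarrow> \<exists>w \<in> lists S. foldl move root w = x"
begin

abbreviation moves :: "'v \<Rightarrow> 'a list \<Rightarrow> 'v" where "moves \<equiv> foldl move"

definition X :: "('v, 'a) labelled_graph" where
  "X = \<lparr> graph_verts = V, graph_labels = S, graph_edges = {(x, a, move x a) | x a. x \<in> V \<and> a \<in> S},
     graph_root = root \<rparr>"

lemma X_simps [simp]: "graph_verts X = V" "graph_labels X = S" "graph_root X = root"
  by (simp_all add: X_def)

lemma edge_X: "(x, a, y) \<in> graph_edges X \<longleftrightarrow> x \<in> V \<and> a \<in> S \<and> y = move x a"
  by (auto simp: X_def)

lemma adjacent_X: "(x, y) \<in> adjacent X \<longleftrightarrow> x \<in> V \<and> (\<exists>a \<in> S. y = move x a)"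
  by (auto simp: adjacent_def edge_X)

lemma inv_in [simp]: "a \<in> S \<Longrightarrow> \<iota> a \<in> S" and inv_inv [simp]: "a \<in> S \<Longrightarrow> \<iota> (\<iota> a) = a"
  using inv_S unfolding fixpoint_free_involution_def by auto

lemma symmetric_X: "symmetric_graph \<iota> X"
  unfolding symmetric_graph_def labelled_graph_def
  using finite_S root_V move_V move_inv inv_S by (auto simp: edge_X)

lemma adjacent_sym: "(x, y) \<in> adjacent X \<Longrightarrow> (y, x) \<in> adjacent X"
  using symmetric_X unfolding symmetric_graph_def adjacent_def by blast

lemma moves_V: "x \<in> V \<Longrightarrow> w \<in> lists S \<Longrightarrow> moves x w \<in> V"
  by (induction w arbitrary: x) (auto simp: move_V)

definition winv :: "'a list \<Rightarrow> 'a list" where "winv w = map \<iota> (rev w)"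

lemma winv_S: "w \<in> lists S \<Longrightarrow> winv w \<in> lists S"
  unfolding winv_def by auto

lemma length_winv [simp]: "length (winv w) = length w"
  by (simp add: winv_def)

lemma moves_winv: "x \<in> V \<Longrightarrow> w \<in> lists S \<Longrightarrow> moves (moves x w) (winv w) = x"
  unfolding winv_def by (induction w arbitrary: x) (auto simp: move_V move_inv)

lemma adjacent_relpow:
  assumes "x \<in> V"
  shows "(x, y) \<in> adjacent X ^^ n \<longleftrightarrow> (\<exists>w \<in> lists S. length w = n \<and> moves x w = y)"
proof (induction n arbitrary: y)
  case (Suc n)
  show ?case
  proof
    assume "(x, y) \<in> adjacent X ^^ Suc n"
    then obtain z where z: "(x, z) \<in> adjacent X ^^ n" "(z, y) \<in> adjacent X" by auto
    from z(1) Suc obtain w where w: "w \<in> lists S" "length w = n" "moves x w = z" by blast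
    from z(2) obtain a where a: "a \<in> S" "y = move z a" unfolding adjacent_X by blast
    show "\<exists>w \<in> lists S. length w = Suc n \<and> moves x w = y"
      by (rule bexI[of _ "w @ [a]"]) (use w a in auto)
  next
    assume "\<exists>w \<in> lists S. length w = Suc n \<and> moves x w = y"
    then obtain w where w: "w \<in> lists S" "length w = Suc n" "moves x w = y" by blast
    then obtain v a where va: "w = v @ [a]" by (cases w rule: rev_cases) auto
    then have "(x, moves x v) \<in> adjacent X ^^ n" using w Suc by auto
    moreover have "(moves x v, y) \<in> adjacent X" using va w moves_V[OF assms, of v] by (auto simp: adjacent_X)
    ultimately show "(x, y) \<in> adjacent X ^^ Suc n" by auto
  qed
qed auto

abbreviation d :: "'v \<Rightarrow> 'v \<Rightarrow> nat" where "d \<equiv> graph_dist X"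

lemma reach_from:
  assumes "x \<in> V" "y \<in> V"
  obtains w where "w \<in> lists S" "moves x w = y"
proof -
  obtain u v where u: "u \<in> lists S" "moves root u = x" and v: "v \<in> lists S" "moves root v = y"
    using reach assms by metis
  have "moves x (winv u @ v) = y" using moves_winv[OF root_V u(1)] u v by simp
  then show thesis using that[of "winv u @ v"] u v winv_S by simp
qed

lemma dist_word:
  assumes "x \<in> V" "y \<in> V"
  obtains w where "w \<in> lists S" "moves x w = y" "length w = d x y"
proof -
  obtain w where "w \<in> lists S" "moves x w = y" using reach_from[OF assms] .
  then have "(x, y) \<in> adjacent X ^^ length w" using adjacent_relpow assms by blast
  then have "(x, y) \<in> adjacent X ^^ d x y" unfolding graph_dist_def by (rule LeastI)
  then show thesis using adjacent_relpow assms that by blast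
qed

lemma dist_le: "x \<in> V \<Longrightarrow> w \<in> lists S \<Longrightarrow> moves x w = y \<Longrightarrow> d x y \<le> length w"
  unfolding graph_dist_def by (rule Least_le) (use adjacent_relpow in blast)

lemma dist_self [simp]: "x \<in> V \<Longrightarrow> d x x = 0"
  using dist_le[of x "[]"] by simp

lemma dist_sym: "x \<in> V \<Longrightarrow> y \<in> V \<Longrightarrow> d x y = d y x"
proof -
  have "d y x \<le> d x y" if "x \<in> V" "y \<in> V" for x y
    using dist_word[OF that] dist_le[of y _ x] that moves_winv winv_S length_winv by metis
  then show "x \<in> V \<Longrightarrow> y \<in> V \<Longrightarrow> d x y = d y x" by (simp add: antisym)
qed

lemma dist_triangle: "x \<in> V \<Longrightarrow> y \<in> V \<Longrightarrow> z \<in> V \<Longrightarrow> d x z \<le> d x y + d y z"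
proof -
  assume V: "x \<in> V" "y \<in> V" "z \<in> V"
  obtain u v where u: "u \<in> lists S" "moves x u = y" "length u = d x y"
    and v: "v \<in> lists S" "moves y v = z" "length v = d y z" using dist_word V by metis
  show "d x z \<le> d x y + d y z" using dist_le[of x "u @ v" z] V u v by simp
qed

lemma dist_move: "x \<in> V \<Longrightarrow> a \<in> S \<Longrightarrow> d (move x a) root \<le> Suc (d x root)"
  using dist_triangle[of "move x a" x root] dist_sym[of x "move x a"] dist_le[of x "[a]"] move_V root_V by simp

lemma connected_X: "connected_graph X"
  unfolding connected_graph_def
proof (intro ballI)
  fix x y assume "x \<in> graph_verts X" "y \<in> graph_verts X"
  then obtain w where "w \<in> lists S" "moves x w = y" using reach_from by auto
  then have "(x, y) \<in> adjacent X ^^ length w" using adjacent_relpow \<open>x \<in> graph_verts X\<close> by auto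
  then show "(x, y) \<in> (adjacent X)\<^sup>*" by (rule relpow_imp_rtrancl)
qed

section \<open>Components, cones and their boundaries\<close>

definition component :: "'v set \<Rightarrow> 'v \<Rightarrow> 'v set" where
  "component U x = {y. (x, y) \<in> (adjacent X \<inter> U \<times> U)\<^sup>*}"

lemma induced_components_eq: "induced_components X U = component U ` U"
  unfolding induced_components_def component_def by blast

lemma component_self: "x \<in> component U x"
  by (simp add: component_def)

lemma component_subset: "x \<in> U \<Longrightarrow> component U x \<subseteq> U"
proof
  fix y assume "x \<in> U" "y \<in> component U x"
  then have "(x, y) \<in> (adjacent X \<inter> U \<times> U)\<^sup>*" unfolding component_def by simp
  then show "y \<in> U" by (induction rule: rtrancl_induct) (use \<open>x \<in> U\<close> in auto)
qed

lemma component_eq: "y \<in> component U x \<Longrightarrow> component U y = component U x"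
proof -
  assume "y \<in> component U x"
  then have xy: "(x, y) \<in> (adjacent X \<inter> U \<times> U)\<^sup>*" unfolding component_def by simp
  have "sym (adjacent X \<inter> U \<times> U)" using adjacent_sym by (auto simp: sym_def)
  then have "(y, x) \<in> (adjacent X \<inter> U \<times> U)\<^sup>*" using xy by (meson sym_rtrancl symD)
  with xy show ?thesis unfolding component_def by (blast intro: rtrancl_trans)
qed

lemma component_move:
  assumes "x \<in> component U x0" "x0 \<in> U" "a \<in> S" "x \<in> V" "move x a \<in> U"
  shows "move x a \<in> component U x0"
proof -
  have "(x, move x a) \<in> adjacent X \<inter> U \<times> U"
    using assms component_subset[of x0 U] by (auto simp: adjacent_X)
  then show ?thesis using assms(1) unfolding component_def by (auto intro: rtrancl_into_rtrancl)
qed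

definition far :: "nat \<Rightarrow> 'v set" where "far n = {x \<in> V. n < d x root}"

lemma cones_eq: "cones X = (\<Union>n. component (far n) ` far n)"
proof -
  have "graph_verts X - {x. graph_dist X x (graph_root X) \<le> n} = far n" for n
    by (auto simp: far_def)
  then show ?thesis unfolding cones_def induced_components_eq by simp
qed

lemma cone_boundary_eq:
  "C \<subseteq> V \<Longrightarrow> cone_boundary X C = {x \<in> C. \<exists>a \<in> S. move x a \<notin> C}"
  unfolding cone_boundary_def adjacent_X by blast

definition stays :: "'v set \<Rightarrow> 'v \<Rightarrow> 'a list \<Rightarrow> bool" where
  "stays C x w \<longleftrightarrow> w \<in> lists S \<and> (\<forall>w1 w2. w = w1 @ w2 \<longrightarrow> moves x w1 \<in> C)"

lemma stays_append: "stays C x (v @ w) \<longleftrightarrow> stays C x v \<and> stays C (moves x v) w"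
proof
  assume l: "stays C x (v @ w)"
  show "stays C x v \<and> stays C (moves x v) w"
    unfolding stays_def
  proof (intro conjI allI impI)
    fix w1 w2 assume "v = w1 @ w2"
    then show "moves x w1 \<in> C" using l unfolding stays_def by (metis append.assoc)
  next
    fix w1 w2 assume "w = w1 @ w2"
    then have "moves x (v @ w1) \<in> C" using l unfolding stays_def by (metis append.assoc)
    then show "moves (moves x v) w1 \<in> C" by simp
  qed (use l in \<open>auto simp: stays_def\<close>)
next
  assume r: "stays C x v \<and> stays C (moves x v) w"
  show "stays C x (v @ w)"
    unfolding stays_def
  proof (intro conjI allI impI)
    fix w1 w2 assume "v @ w = w1 @ w2"
    then obtain us where "v = w1 @ us \<or> w1 = v @ us \<and> w = us @ w2"
      unfolding append_eq_append_conv2 by auto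
    then show "moves x w1 \<in> C" using r unfolding stays_def by auto
  qed (use r in \<open>auto simp: stays_def\<close>)
qed

lemma stays_Nil [simp]: "stays C x [] \<longleftrightarrow> x \<in> C"
  by (simp add: stays_def)

lemma stays_single: "stays C x [a] \<longleftrightarrow> a \<in> S \<and> x \<in> C \<and> move x a \<in> C"
  unfolding stays_def by (auto simp: Cons_eq_append_conv) (metis foldl_Cons foldl_Nil)

lemma stays_snoc: "stays C x (w @ [a]) \<longleftrightarrow> stays C x w \<and> a \<in> S \<and> move (moves x w) a \<in> C"
proof -
  have "moves x w \<in> C" if "stays C x w" using that unfolding stays_def by (metis append_Nil2)
  then show ?thesis by (auto simp: stays_append stays_single)
qed

lemma staysD: "stays C x w \<Longrightarrow> w \<in> lists S" "stays C x w \<Longrightarrow> x \<in> C" "stays C x w \<Longrightarrow> moves x w \<in> C"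
  unfolding stays_def by (blast, metis append_Nil foldl_Nil, metis append_Nil2)

lemma stays_winv: "C \<subseteq> V \<Longrightarrow> stays C x w \<Longrightarrow> stays C (moves x w) (winv w)"
proof (induction w rule: rev_induct)
  case (snoc a w)
  have "moves x w \<in> V" "a \<in> S" using snoc.prems staysD(3) stays_snoc by blast+
  moreover have "winv (w @ [a]) = [\<iota> a] @ winv w" by (simp add: winv_def)
  ultimately show ?case using snoc move_inv
    by (simp add: stays_append[of C _ "[\<iota> a]", simplified] stays_snoc stays_single staysD(3))
qed (simp add: winv_def)

lemma component_stays:
  assumes "x \<in> component U x0" "y \<in> component U x0" "x0 \<in> U" "U \<subseteq> V"
  obtains w where "stays (component U x0) x w" "moves x w = y"
proof -
  have "(x, y) \<in> (adjacent X \<inter> U \<times> U)\<^sup>*"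
    using assms(2) component_eq[OF assms(1)] unfolding component_def[of U x] by auto
  then have "\<exists>w. stays (component U x0) x w \<and> moves x w = y"
  proof (induction rule: rtrancl_induct)
    case base
    then show ?case using assms(1) by (intro exI[of _ "[]"]) simp
  next
    case (step y z)
    then obtain w a where w: "stays (component U x0) x w" "moves x w = y" and a: "a \<in> S" "z = move y a"
      by (auto simp: adjacent_X)
    have "z \<in> component U x0"
      using component_move[of y U x0 a] staysD(3)[OF w(1)] w step a assms by auto
    then show ?case using w a by (intro exI[of _ "w @ [a]"]) (simp add: stays_snoc)
  qed
  then show thesis using that by blast
qed

lemma coneE:
  assumes "C \<in> cones X"
  obtains n x0 where "x0 \<in> far n" "C = component (far n) x0" "C \<subseteq> far n" "C \<subseteq> V" "x0 \<in> C"
proof -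
  obtain n x0 where *: "x0 \<in> far n" "C = component (far n) x0" using assms unfolding cones_eq by blast
  then have "C \<subseteq> far n" using component_subset by blast
  moreover have "C \<subseteq> V" "x0 \<in> C" using * \<open>C \<subseteq> far n\<close> component_self by (auto simp: far_def)
  ultimately show thesis using that * by blast
qed

lemma cone_subset: "C \<in> cones X \<Longrightarrow> C \<subseteq> V"
  using coneE by metis

lemma cone_stays:
  assumes "C \<in> cones X" "x \<in> C" "y \<in> C"
  obtains w where "stays C x w" "moves x w = y"
proof -
  obtain n x0 where n: "x0 \<in> far n" "C = component (far n) x0" using coneE[OF assms(1)] by metis
  moreover have "far n \<subseteq> V" by (auto simp: far_def)
  ultimately show thesis using component_stays[of x "far n" x0 y] assms that by metis
qed

text \<open>A neighbour of \<open>y\<close> in \<open>far n\<close> would belong to the same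
  component. So a neighbour outside the cone has distance at most \<open>n\<close> from the root,
  and \<open>y\<close> is just one step further away.\<close>

lemma boundary_dist:
  assumes "x0 \<in> far n" "y \<in> cone_boundary X (component (far n) x0)"
  shows "d y root = Suc n"
proof -
  let ?C = "component (far n) x0"
  have C: "?C \<subseteq> far n" "far n \<subseteq> V" using assms component_subset by (auto simp: far_def)
  obtain a where a: "y \<in> ?C" "a \<in> S" "move y a \<notin> ?C"
    using assms cone_boundary_eq[of ?C] C by auto
  then have yV: "y \<in> V" using C by blast
  then have "move y a \<notin> far n" using component_move[of y "far n" x0 a] a assms by blast
  then have "d (move y a) root \<le> n" using move_V a yV by (auto simp: far_def)
  then have "d y root \<le> Suc n"
    using dist_move[of "move y a" "\<iota> a"] move_inv move_V a yV by simp
  moreover have "n < d y root" using a C by (auto simp: far_def)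
  ultimately show ?thesis by simp
qed

text \<open>Removing the boundary of a cone cut out at distance \<open>n\<close> leaves exactly its
  vertices in \<open>far (Suc n)\<close>. Hence the cones of the next level inside \<open>C\<close>
  can be found from \<open>C\<close> and its boundary, without reference to the root; the automaton
  relies on this when it descends inside a representative.\<close>

lemma component_minus_boundary:
  assumes "C \<in> cones X" "y \<in> C - cone_boundary X C"
  shows "component (C - cone_boundary X C) y \<in> cones X"
proof -
  obtain n x0 where n: "x0 \<in> far n" "C = component (far n) x0" "C \<subseteq> far n" "C \<subseteq> V"
    using coneE[OF assms(1)] by metis
  let ?B = "cone_boundary X C" and ?U = "C - cone_boundary X C"
  have U: "?U = C \<inter> far (Suc n)"
  proof -
    have "x \<in> far (Suc n)" if "x \<in> ?U" for x
    proof (rule ccontr)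
      assume "x \<notin> far (Suc n)"
      then have xs: "d x root = Suc n" "x \<in> V" using that n by (auto simp: far_def)
      \<comment> \<open>The first edge of a geodesic to the root already leaves \<open>C\<close>, so
        \<open>x\<close> would be a boundary vertex.\<close>
      then obtain w where w: "w \<in> lists S" "moves x w = root" "length w = Suc n" using dist_word root_V by metis
      then obtain a v where av: "w = a # v" by (cases w) auto
      then have "d (move x a) root \<le> n" using w dist_le[of "move x a" v root] move_V xs by auto
      then have "move x a \<notin> C" using n by (auto simp: far_def)
      then show False using that av w cone_boundary_eq[OF n(4)] by auto
    qed
    moreover have "x \<notin> ?B" if "x \<in> far (Suc n)" for x
      using boundary_dist[OF n(1), of x] n(2) that by (auto simp: far_def)
    ultimately show ?thesis by blast
  qed
  have y: "y \<in> C" "y \<in> far (Suc n)" using assms U by auto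
  have "component ?U y = component (far (Suc n)) y"
  proof
    show "component ?U y \<subseteq> component (far (Suc n)) y"
      unfolding component_def U by (auto elim: rtrancl_mono[THEN subsetD, rotated])
    show "component (far (Suc n)) y \<subseteq> component ?U y"
    proof
      fix z assume "z \<in> component (far (Suc n)) y"
      then have "(y, z) \<in> (adjacent X \<inter> far (Suc n) \<times> far (Suc n))\<^sup>*" unfolding component_def by simp
      then have "z \<in> component ?U y \<and> z \<in> C"
      proof (induction rule: rtrancl_induct)
        case base
        then show ?case using y component_self by simp
      next
        case (step u v)
        then obtain a where a: "a \<in> S" "v = move u a" "u \<in> V" by (auto simp: adjacent_X)
        have "v \<in> far n" using step by (auto simp: far_def)
        then have "v \<in> C" using component_move[of u "far n" x0 a] step a n by auto
        then have "v \<in> ?U" using U step by auto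
        then show ?case using component_move[of u ?U y a] step a assms \<open>v \<in> C\<close> by auto
      qed
      then show "z \<in> component ?U y" by simp
    qed
  qed
  then show ?thesis unfolding cones_eq using y by blast
qed

lemma component_minus_root: "y \<in> V - {root} \<Longrightarrow> component (V - {root}) y \<in> cones X"
proof -
  have "d x root = 0 \<longleftrightarrow> x = root" if "x \<in> V" for x
    using dist_word[OF that root_V] root_V by (metis dist_self foldl_Nil length_0_conv)
  then have "V - {root} = far 0" by (auto simp: far_def)
  then show "y \<in> V - {root} \<Longrightarrow> component (V - {root}) y \<in> cones X" unfolding cones_eq by auto
qed

lemma cone_root: "C \<in> cones X \<Longrightarrow> root \<notin> C"
  by (elim coneE) (use root_V in \<open>auto simp: far_def\<close>)

text \<open>Without a boundary vertex no path could leave \<open>C\<close>, yet some path leads to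
  the root, which is outside every cone.\<close>

lemma cone_boundary_nonempty:
  assumes "C \<in> cones X"
  shows "cone_boundary X C \<noteq> {}"
proof
  assume e: "cone_boundary X C = {}"
  have C: "C \<subseteq> V" using assms cone_subset by blast
  obtain x where x: "x \<in> C" using assms coneE by metis
  obtain w where w: "w \<in> lists S" "moves x w = root" using reach_from x C root_V by blast
  have "moves x w \<in> C" using w(1) 
    by (induction w rule: rev_induct) (use e x cone_boundary_eq[OF C] in auto)
  then show False using cone_root[OF assms] w by simp
qed

lemma finite_cone_boundary:
  assumes "C \<in> cones X"
  shows "finite (cone_boundary X C)"
proof -
  obtain n x0 where n: "x0 \<in> far n" "C = component (far n) x0" "C \<subseteq> V" using coneE[OF assms] by metis
  have "cone_boundary X C \<subseteq> moves root ` {w. set w \<subseteq> S \<and> length w \<le> Suc n}"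
  proof
    fix y assume y: "y \<in> cone_boundary X C"
    then have "y \<in> V" using n(3) by (auto simp: cone_boundary_def)
    moreover have "d root y = Suc n" using boundary_dist[OF n(1)] y n dist_sym root_V \<open>y \<in> V\<close> by metis
    ultimately obtain w where "w \<in> lists S" "moves root w = y" "length w = Suc n" using dist_word root_V by metis
    then show "y \<in> moves root ` {w. set w \<subseteq> S \<and> length w \<le> Suc n}" by (auto intro!: image_eqI[of _ _ w])
  qed
  then show ?thesis using finite_lists_length_le[OF finite_S] finite_surj by blast
qed

section \<open>Isomorphism types of cones\<close>

lemma cone_iso_refl: "cone_iso X C C"
  unfolding cone_iso_def by (rule exI[of _ id]) simp

lemma cone_iso_sym:
  assumes "cone_iso X C D"
  shows "cone_iso X D C"
proof -
  obtain f where f: "bij_betw f C D" "f ` cone_boundary X C = cone_boundary X D"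
    and e: "\<And>x y a. x \<in> C \<Longrightarrow> y \<in> C \<Longrightarrow> (x, a, y) \<in> graph_edges X \<longleftrightarrow> (f x, a, f y) \<in> graph_edges X"
    using assms unfolding cone_iso_def by blast
  let ?g = "inv_into C f"
  have "cone_boundary X C \<subseteq> C" by (auto simp: cone_boundary_def)
  then have "?g ` cone_boundary X D = cone_boundary X C"
    unfolding f(2)[symmetric] using f(1) by (simp add: bij_betw_def inv_into_image_cancel)
  moreover have "bij_betw ?g D C" using f(1) by (rule bij_betw_inv_into)
  moreover have "(x, a, y) \<in> graph_edges X \<longleftrightarrow> (?g x, a, ?g y) \<in> graph_edges X" if "x \<in> D" "y \<in> D" for x y a
    using e[of "?g x" "?g y" a] that f(1) by (simp add: bij_betw_def inv_into_into f_inv_into_f)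
  ultimately show ?thesis unfolding cone_iso_def by blast
qed

lemma cone_iso_trans:
  assumes "cone_iso X C D" "cone_iso X D E"
  shows "cone_iso X C E"
proof -
  obtain f where f: "bij_betw f C D" "f ` cone_boundary X C = cone_boundary X D"
    and ef: "\<And>x y a. x \<in> C \<Longrightarrow> y \<in> C \<Longrightarrow> (x, a, y) \<in> graph_edges X \<longleftrightarrow> (f x, a, f y) \<in> graph_edges X"
    using assms(1) unfolding cone_iso_def by blast
  obtain g where g: "bij_betw g D E" "g ` cone_boundary X D = cone_boundary X E"
    and eg: "\<And>x y a. x \<in> D \<Longrightarrow> y \<in> D \<Longrightarrow> (x, a, y) \<in> graph_edges X \<longleftrightarrow> (g x, a, g y) \<in> graph_edges X"
    using assms(2) unfolding cone_iso_def by blast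
  show ?thesis
    unfolding cone_iso_def
  proof (intro exI[of _ "g \<circ> f"] conjI ballI allI)
    show "bij_betw (g \<circ> f) C E" using f(1) g(1) by (rule bij_betw_trans)
    show "(g \<circ> f) ` cone_boundary X C = cone_boundary X E" using f(2) g(2) by (metis image_comp)
    show "(x, a, y) \<in> graph_edges X \<longleftrightarrow> ((g \<circ> f) x, a, (g \<circ> f) y) \<in> graph_edges X"
      if "x \<in> C" "y \<in> C" for x y a
      using ef[OF that] eg[of "f x" "f y"] that f(1) by (auto simp: bij_betw_def)
  qed
qed

abbreviation cone_rel :: "('v set \<times> 'v set) set" where
  "cone_rel \<equiv> {(C, D). C \<in> cones X \<and> D \<in> cones X \<and> cone_iso X C D}"

lemma cone_rel_class: "cone_iso X C D \<Longrightarrow> C \<in> cones X \<Longrightarrow> D \<in> cones X \<Longrightarrow> cone_rel `` {C} = cone_rel `` {D}"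
  using cone_iso_sym cone_iso_trans by blast

text \<open>The value \<open>t C\<close> only has to determine the type of \<open>C\<close>;
  isomorphic cones may get different values. So data read off at an arbitrarily chosen boundary
  vertex will do.\<close>

lemma context_free_graphI:
  assumes "finite T" "\<And>C. C \<in> cones X \<Longrightarrow> t C \<in> T"
    "\<And>C D. C \<in> cones X \<Longrightarrow> D \<in> cones X \<Longrightarrow> t C = t D \<Longrightarrow> cone_iso X C D"
  shows "context_free_graph \<iota> X"
proof -
  let ?h = "\<lambda>\<tau>. cone_rel `` {SOME D. D \<in> cones X \<and> t D = \<tau>}"
  have "cone_rel `` {C} = ?h (t C)" if "C \<in> cones X" for C
  proof -
    let ?D = "SOME D. D \<in> cones X \<and> t D = t C"
    have "?D \<in> cones X \<and> t ?D = t C" using that by (intro someI[of "\<lambda>D. D \<in> cones X \<and> t D = t C" C]) auto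
    then show ?thesis using assms(3)[of C ?D] that by (intro cone_rel_class) metis+
  qed
  then have "cones X // cone_rel \<subseteq> ?h ` T" using assms(2) unfolding quotient_def by blast
  then have "finite (cones X // cone_rel)" using assms(1) finite_surj by blast
  then show ?thesis unfolding context_free_graph_def using symmetric_X connected_X by simp
qed

end

section \<open>Graphs with a context-free language of loops\<close>

text \<open>Two alphabets act on the same vertices: \<open>S\<close> defines the graph and its
  cones, \<open>S'\<close> is the alphabet of the given context-free language. Each letter of one
  acts like a word in the other, which covers a change of generators. Keeping \<open>base\<close>
  apart from \<open>root\<close> covers conjugation of the subgroup.\<close>

locale translated_graph = complete_symmetric_graph V S \<iota> move root
  for V :: "'v set" and S :: "'a set" and \<iota> and move and root +
  fixes S' :: "'b set" and move' :: "'v \<Rightarrow> 'b \<Rightarrow> 'v" and \<phi> :: "'a \<Rightarrow> 'b list" and \<eta> :: "'b \<Rightarrow> 'a list"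
    and base :: 'v and F :: "'b list set set"
  assumes base_V: "base \<in> V"
    and \<phi>_S': "a \<in> S \<Longrightarrow> \<phi> a \<in> lists S'"
    and \<phi>_move: "x \<in> V \<Longrightarrow> a \<in> S \<Longrightarrow> foldl move' x (\<phi> a) = move x a"
    and \<eta>_S: "b \<in> S' \<Longrightarrow> \<eta> b \<in> lists S"
    and \<eta>_move: "x \<in> V \<Longrightarrow> b \<in> S' \<Longrightarrow> foldl move x (\<eta> b) = move' x b"
    and family: "splitting_family S' F"
    and loops: "{w \<in> lists S'. foldl move' base w = base} \<in> F"
begin

abbreviation moves' :: "'v \<Rightarrow> 'b list \<Rightarrow> 'v" where "moves' \<equiv> foldl move'"
abbreviation \<Phi> :: "'a list \<Rightarrow> 'b list" where "\<Phi> w \<equiv> concat (map \<phi> w)"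
abbreviation H :: "'b list \<Rightarrow> 'a list" where "H w \<equiv> concat (map \<eta> w)"

lemma F_lists: "A \<in> F \<Longrightarrow> A \<subseteq> lists S'"
  using family unfolding splitting_family_def by blast

lemma H_S: "w \<in> lists S' \<Longrightarrow> H w \<in> lists S"
  by (induction w) (auto dest: \<eta>_S)

lemma moves_H: "x \<in> V \<Longrightarrow> w \<in> lists S' \<Longrightarrow> moves x (H w) = moves' x w"
proof (induction w arbitrary: x)
  case (Cons b w)
  then have "move' x b \<in> V" using moves_V[of x "\<eta> b"] \<eta>_S \<eta>_move by auto
  then show ?case using Cons \<eta>_move by simp
qed simp

lemma moves'_V: "x \<in> V \<Longrightarrow> w \<in> lists S' \<Longrightarrow> moves' x w \<in> V"
  using moves_H[of x w] moves_V[of x "H w"] H_S[of w] by simp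

lemma \<Phi>_S': "w \<in> lists S \<Longrightarrow> \<Phi> w \<in> lists S'"
  by (induction w) (auto dest: \<phi>_S')

lemma moves'_\<Phi>: "x \<in> V \<Longrightarrow> w \<in> lists S \<Longrightarrow> moves' x (\<Phi> w) = moves x w"
  by (induction w arbitrary: x) (auto simp: \<phi>_move move_V)

text \<open>A word over \<open>S'\<close> acts like a word over \<open>S\<close>, and the latter can
  be undone by its inverse. Injectivity is what allows cancelling a factor of a word when diagonals
  are constructed.\<close>

lemma moves'_inj:
  assumes "x \<in> V" "y \<in> V" "w \<in> lists S'" "moves' x w = moves' y w"
  shows "x = y"
  using moves_winv[OF assms(1) H_S[OF assms(3)]] moves_winv[OF assms(2) H_S[OF assms(3)]]
    moves_H assms by simp

lemma dist_moves': "x \<in> V \<Longrightarrow> w \<in> lists S' \<Longrightarrow> moves' x w = y \<Longrightarrow> d x y \<le> length (H w)"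
  using dist_le[of x "H w" y] moves_H[of x w] H_S[of w] by simp

section \<open>Diagonals and chains of diagonals\<close>

text \<open>The diagonals of the polygon. The condition is vacuous for an empty language, which is
  why facts about distances also ask for a word in \<open>A\<close>.\<close>

definition links :: "'b list set \<Rightarrow> 'v \<Rightarrow> 'v \<Rightarrow> bool" where
  "links A x y \<longleftrightarrow> (\<forall>w \<in> A. moves' x w = y)"

lemma links_dist_bound:
  obtains D where "\<And>A w x y. A \<in> F \<Longrightarrow> w \<in> A \<Longrightarrow> x \<in> V \<Longrightarrow> links A x y \<Longrightarrow> d x y \<le> D"
proof -
  \<comment> \<open>One word per language suffices, since in a linking language every word joins the
    same two vertices. For an empty language the choice is arbitrary and can only enlarge the
    maximum.\<close>
  define D where "D = Max ((\<lambda>A. length (H (SOME w. w \<in> A))) ` F)"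
  have "d x y \<le> D" if A: "A \<in> F" "w \<in> A" and x: "x \<in> V" "links A x y" for A w x y
  proof -
    let ?w = "SOME w. w \<in> A"
    have w: "?w \<in> A" using A(2) by (rule someI)
    have "length (H ?w) \<le> D"
      unfolding D_def using A family by (intro Max_ge) (auto simp: splitting_family_def)
    moreover have "d x y \<le> length (H ?w)"
      using dist_moves'[of x ?w y] w x F_lists[OF A(1)] unfolding links_def by blast
    ultimately show ?thesis by simp
  qed
  then show thesis using that by blast
qed

text \<open>\<open>Z\<close> constrains only the cut points between consecutive pieces, not the two ends.\<close>

inductive linked :: "'v set \<Rightarrow> 'v \<Rightarrow> 'b list \<Rightarrow> 'v \<Rightarrow> bool" for Z where
  empty: "linked Z x [] x"
| link: "A \<in> F \<Longrightarrow> links A x y \<Longrightarrow> w \<in> A \<Longrightarrow> linked Z x w y"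
| trans: "linked Z x v z \<Longrightarrow> z \<in> Z \<Longrightarrow> linked Z z w y \<Longrightarrow> linked Z x (v @ w) y"

lemma linked_mono: "linked Z x w y \<Longrightarrow> Z \<subseteq> Z' \<Longrightarrow> linked Z' x w y"
  by (induction rule: linked.induct) (auto intro: linked.intros)

lemma linked_V: "linked Z x w y \<Longrightarrow> x \<in> V \<Longrightarrow> y \<in> V"
proof (induction rule: linked.induct)
  case (link A x y w)
  then show ?case using moves'_V[of x w] F_lists[of A] by (auto simp: links_def)
qed auto

text \<open>\<open>u\<close> and \<open>v\<close> are the sides of the polygon before and after
  \<open>w\<close>; a cut point on \<open>w\<close> is the end of a short diagonal leading to one of
  these sides. Requiring \<open>u2\<close> and \<open>v1\<close> to be nonempty excludes the ends of
  \<open>w\<close> themselves: after a cut inside \<open>w\<close> one of the two sides is empty in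
  each half, and its only vertex would be the new cut point instead of a vertex of a true
  side.\<close>

definition cuts :: "nat \<Rightarrow> 'v \<Rightarrow> 'b list \<Rightarrow> 'b list \<Rightarrow> 'b list \<Rightarrow> 'v set" where
  "cuts D x u w v = {z. \<exists>w1 w2. w = w1 @ w2 \<and> z = moves' x (u @ w1) \<and>
     ((\<exists>u1 u2. u = u1 @ u2 \<and> u2 \<noteq> [] \<and> d (moves' x u1) z \<le> D) \<or>
      (\<exists>v1 v2. v = v1 @ v2 \<and> v1 \<noteq> [] \<and> d z (moves' x (u @ w @ v1)) \<le> D))}"

lemma cutsI:
  "w = w1 @ w2 \<Longrightarrow> z = moves' x (u @ w1) \<Longrightarrow>
   (\<exists>u1 u2. u = u1 @ u2 \<and> u2 \<noteq> [] \<and> d (moves' x u1) z \<le> D) \<or>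
   (\<exists>v1 v2. v = v1 @ v2 \<and> v1 \<noteq> [] \<and> d z (moves' x (u @ w @ v1)) \<le> D) \<Longrightarrow> z \<in> cuts D x u w v"
  unfolding cuts_def by blast

text \<open>Only splits that separate letters of \<open>w\<close> create cut points; the derivation is followed
  downwards until it no longer meets \<open>u\<close> or \<open>v\<close>.\<close>

lemma linked_cuts:
  assumes D: "\<And>A w x y. A \<in> F \<Longrightarrow> w \<in> A \<Longrightarrow> x \<in> V \<Longrightarrow> links A x y \<Longrightarrow> d x y \<le> D"
    and A: "A \<in> F" "u @ w @ v \<in> A" "x \<in> V" "links A x y"
  shows "linked (cuts D x u w v) (moves' x u) w (moves' x (u @ w))"
  using A
proof (induction "length (u @ w @ v)" arbitrary: A u w v x y rule: less_induct)
  case less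
  note x = less.prems(3)
  have "u @ w @ v \<in> lists S'" using less.prems F_lists by blast
  then have S': "u \<in> lists S'" "w \<in> lists S'" "v \<in> lists S'" by auto
  consider "w = []" | "w \<noteq> []" "u = []" "v = []" | "w \<noteq> []" "u \<noteq> [] \<or> v \<noteq> []" by blast
  then show ?case
  proof cases
    case 1
    then show ?thesis by (auto intro: linked.empty)
  next
    case 2
    then show ?thesis using less.prems by (auto intro!: linked.link[of A] simp: links_def)
  next
    case 3
    then have "2 \<le> length (u @ w @ v)" by (cases u; cases v; cases w) auto
    then obtain b c B C where bc: "u @ w @ v = b @ c" "b \<noteq> []" "c \<noteq> []" "B \<in> F" "C \<in> F" "b \<in> B" "c \<in> C"
      and BC: "\<And>b' c'. b' \<in> B \<Longrightarrow> c' \<in> C \<Longrightarrow> b' @ c' \<in> A"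
      using less.prems family unfolding splitting_family_def splits_in_def by metis
    have bS: "b \<in> lists S'" "c \<in> lists S'" using bc F_lists by blast+
    let ?t = "moves' x b"
    have t: "?t \<in> V" using moves'_V x bS by blast
    have linkC: "links C ?t y"
      unfolding links_def using BC[OF \<open>b \<in> B\<close>] less.prems(4) unfolding links_def by (metis foldl_append)
    \<comment> \<open>Followed by the fixed word \<open>c\<close>, all words of \<open>B\<close> end
      at \<open>y\<close>; as \<open>c\<close> acts injectively, they already agree before
      \<open>c\<close>.\<close>
    have linkB: "links B x ?t"
      unfolding links_def
    proof
      fix b' assume b': "b' \<in> B"
      have "moves' (moves' x b') c = moves' ?t c"
        using BC[OF b' \<open>c \<in> C\<close>] BC[OF \<open>b \<in> B\<close> \<open>c \<in> C\<close>] less.prems(4) unfolding links_def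
        by (metis foldl_append)
      moreover have "moves' x b' \<in> V" using moves'_V x b' F_lists bc by blast
      ultimately show "moves' x b' = ?t" using moves'_inj t bS by blast
    qed
    have lb: "length b < length (u @ w @ v)" "length c < length (u @ w @ v)" using bc by auto
    consider us where "u = b @ us" "c = us @ w @ v"
      | vs where "b = u @ w @ vs" "v = vs @ c"
      | w1 w2 where "w = w1 @ w2" "b = u @ w1" "c = w2 @ v"
    proof -
      obtain us where us: "u = b @ us \<and> us @ w @ v = c \<or> u @ us = b \<and> w @ v = us @ c"
        using bc(1) unfolding append_eq_append_conv2 by blast
      show thesis
      proof (cases "u = b @ us \<and> us @ w @ v = c")
        case False
        then have *: "u @ us = b" "w @ v = us @ c" using us by auto
        then obtain ws where "w = us @ ws \<and> ws @ v = c \<or> w @ ws = us \<and> v = ws @ c"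
          unfolding append_eq_append_conv2 by blast
        then show thesis using * that by auto
      qed (use that in auto)
    qed
    then show ?thesis
    proof cases
      case 1
      have "linked (cuts D ?t us w v) (moves' ?t us) w (moves' ?t (us @ w))"
        using less.hyps[OF _ \<open>C \<in> F\<close> _ t linkC, of us w v] lb bc 1 by simp
      moreover have "cuts D ?t us w v \<subseteq> cuts D x u w v"
      proof
        fix z assume "z \<in> cuts D ?t us w v"
        then obtain w1 w2 where z: "w = w1 @ w2" "z = moves' ?t (us @ w1)"
          "(\<exists>u1 u2. us = u1 @ u2 \<and> u2 \<noteq> [] \<and> d (moves' ?t u1) z \<le> D) \<or>
           (\<exists>v1 v2. v = v1 @ v2 \<and> v1 \<noteq> [] \<and> d z (moves' ?t (us @ w @ v1)) \<le> D)"
          unfolding cuts_def by blast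
        from z(3) have "(\<exists>u1 u2. u = u1 @ u2 \<and> u2 \<noteq> [] \<and> d (moves' x u1) z \<le> D) \<or>
           (\<exists>v1 v2. v = v1 @ v2 \<and> v1 \<noteq> [] \<and> d z (moves' x (u @ w @ v1)) \<le> D)"
        proof (elim disjE exE conjE)
          fix u1 u2 assume "us = u1 @ u2" "u2 \<noteq> []" "d (moves' ?t u1) z \<le> D"
          then have "u = (b @ u1) @ u2 \<and> u2 \<noteq> [] \<and> d (moves' x (b @ u1)) z \<le> D" using 1 by simp
          then show ?thesis by blast
        qed (use 1 in auto)
        then show "z \<in> cuts D x u w v" using z(1,2) 1 by (intro cutsI) auto
      qed
      ultimately show ?thesis using 1 linked_mono by fastforce
    next
      case 2
      have "linked (cuts D x u w vs) (moves' x u) w (moves' x (u @ w))"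
        using less.hyps[OF _ \<open>B \<in> F\<close> _ x linkB, of u w vs] lb bc 2 by simp
      moreover have "cuts D x u w vs \<subseteq> cuts D x u w v"
      proof
        fix z assume "z \<in> cuts D x u w vs"
        then obtain w1 w2 where z: "w = w1 @ w2" "z = moves' x (u @ w1)"
          "(\<exists>u1 u2. u = u1 @ u2 \<and> u2 \<noteq> [] \<and> d (moves' x u1) z \<le> D) \<or>
           (\<exists>v1 v2. vs = v1 @ v2 \<and> v1 \<noteq> [] \<and> d z (moves' x (u @ w @ v1)) \<le> D)"
          unfolding cuts_def by blast
        have "\<exists>v1 v2. v = v1 @ v2 \<and> v1 \<noteq> [] \<and> d z (moves' x (u @ w @ v1)) \<le> D"
          if "vs = v1 @ v2" "v1 \<noteq> []" "d z (moves' x (u @ w @ v1)) \<le> D" for v1 v2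
          by (rule exI[of _ v1]) (use that 2 in auto)
        then show "z \<in> cuts D x u w v"
          using z unfolding cuts_def by blast
      qed
      ultimately show ?thesis using linked_mono by blast
    next
      case 3
      have L: "linked (cuts D x u w1 []) (moves' x u) w1 ?t"
        using less.hyps[OF _ \<open>B \<in> F\<close> _ x linkB, of u w1 "[]"] lb bc 3 by simp
      have R: "linked (cuts D ?t [] w2 v) ?t w2 (moves' ?t w2)"
        using less.hyps[OF _ \<open>C \<in> F\<close> _ t linkC, of "[]" w2 v] lb bc 3 by simp
      have "cuts D x u w1 [] \<subseteq> cuts D x u w v"
      proof
        fix z assume "z \<in> cuts D x u w1 []"
        then obtain w3 w4 where z: "w1 = w3 @ w4" "z = moves' x (u @ w3)"
          "\<exists>u1 u2. u = u1 @ u2 \<and> u2 \<noteq> [] \<and> d (moves' x u1) z \<le> D"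
          unfolding cuts_def by auto
        then show "z \<in> cuts D x u w v"
          using 3 by (intro cutsI[of _ w3 "w4 @ w2"]) auto
      qed
      moreover have "cuts D ?t [] w2 v \<subseteq> cuts D x u w v"
      proof
        fix z assume "z \<in> cuts D ?t [] w2 v"
        then obtain w3 w4 where "w2 = w3 @ w4" "z = moves' ?t ([] @ w3)"
          "(\<exists>u1 u2. [] = u1 @ u2 \<and> u2 \<noteq> [] \<and> d (moves' ?t u1) z \<le> D) \<or>
           (\<exists>v1 v2. v = v1 @ v2 \<and> v1 \<noteq> [] \<and> d z (moves' ?t ([] @ w2 @ v1)) \<le> D)"
          unfolding cuts_def by blast
        then have "w = (w1 @ w3) @ w4" "z = moves' x (u @ (w1 @ w3))"
          "\<exists>v1 v2. v = v1 @ v2 \<and> v1 \<noteq> [] \<and> d z (moves' x (u @ w @ v1)) \<le> D"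
          using 3 by auto
        then show "z \<in> cuts D x u w v" unfolding cuts_def by blast
      qed
      \<comment> \<open>The language \<open>B\<close> links the beginning of \<open>u\<close> to the
        cut point, and \<open>C\<close> links the cut point to the end of \<open>v\<close>.
        Whichever side is nonempty supplies the diagonal.\<close>
      moreover have "?t \<in> cuts D x u w v"
      proof -
        have "(\<exists>u1 u2. u = u1 @ u2 \<and> u2 \<noteq> [] \<and> d (moves' x u1) ?t \<le> D) \<or>
          (\<exists>v1 v2. v = v1 @ v2 \<and> v1 \<noteq> [] \<and> d ?t (moves' x (u @ w @ v1)) \<le> D)"
        proof (cases "u = []")
          case False
          then show ?thesis
            using D[OF \<open>B \<in> F\<close> \<open>b \<in> B\<close> x linkB] by - (rule disjI1, rule exI[of _ "[]"], rule exI[of _ u], simp)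
        next
          case True
          then have "v \<noteq> []" using \<open>u \<noteq> [] \<or> v \<noteq> []\<close> by blast
          moreover have "y = moves' x (u @ w @ v)" using less.prems(2,4) unfolding links_def by metis
          ultimately show ?thesis
            using D[OF \<open>C \<in> F\<close> \<open>c \<in> C\<close> t linkC] by - (rule disjI2, rule exI[of _ v], rule exI[of _ "[]"], simp)
        qed
        then show ?thesis using 3 unfolding cuts_def by blast
      qed
      ultimately have "linked (cuts D x u w v) (moves' x u) (w1 @ w2) (moves' ?t w2)"
        using linked.trans[OF linked_mono[OF L] _ linked_mono[OF R]] by blast
      then show ?thesis using 3 by simp
    qed
  qed
qed

text \<open>Some link of the chain passes from \<open>P\<close> to its complement, links have length
  at most \<open>D\<close>, and the end of a link is a cut point or the end of the chain. It is used
  with \<open>P\<close> being a ball around \<open>x\<close>.\<close>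

lemma linked_jump:
  assumes D: "\<And>A w x y. A \<in> F \<Longrightarrow> w \<in> A \<Longrightarrow> x \<in> V \<Longrightarrow> links A x y \<Longrightarrow> d x y \<le> D"
    and "linked Z x w y" "x \<in> V" "P x" "\<not> P y"
  shows "\<exists>a \<in> V. \<exists>b \<in> V. P a \<and> \<not> P b \<and> (b \<in> Z \<or> b = y) \<and> d a b \<le> D"
  using assms(2-)
proof (induction rule: linked.induct)
  case (link A x y w)
  have "y \<in> V" using linked_V linked.link link by metis
  then show ?case using D link by blast
next
  case (trans x v z w y)
  then show ?case using linked_V by (cases "P z") blast+
qed simp

text \<open>A prefix of \<open>\<Phi> w\<close> may stop inside the translation of a letter and so
  leave the path labelled \<open>w\<close>. It has then strayed from the last vertex of that path by
  no more than the length of this translation.\<close>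

lemma prefix_near:
  assumes c: "\<And>a. a \<in> S \<Longrightarrow> length (H (\<phi> a)) \<le> c"
    and "x \<in> V" "w \<in> lists S" "\<Phi> w = p @ q"
  shows "\<exists>w1 w2. w = w1 @ w2 \<and> d (moves' x p) (moves x w1) \<le> c"
  using assms(2-)
proof (induction w arbitrary: x p)
  case Nil
  then show ?case by simp
next
  case (Cons a w)
  have a: "a \<in> S" "w \<in> lists S" using Cons.prems by auto
  obtain us where us: "\<phi> a = p @ us \<and> us @ \<Phi> w = q \<or> \<phi> a @ us = p \<and> \<Phi> w = us @ q"
    using Cons.prems(3) by (auto simp: append_eq_append_conv2)
  then show ?case
  proof (elim disjE conjE)
    assume *: "\<phi> a = p @ us"
    then have p: "p \<in> lists S'" using \<phi>_S'[OF a(1)] by simp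
    have "d x (moves' x p) \<le> length (H p)" using dist_moves' Cons.prems(1) p by simp
    also have "\<dots> \<le> c" using c[OF a(1)] * by simp
    finally have "d (moves' x p) (moves x []) \<le> c"
      using dist_sym[of x "moves' x p"] Cons.prems(1) moves'_V p by simp
    then show ?thesis by (metis append_Nil)
  next
    assume *: "\<phi> a @ us = p" "\<Phi> w = us @ q"
    obtain w1 w2 where "w = w1 @ w2" "d (moves' (move x a) us) (moves (move x a) w1) \<le> c"
      using Cons.IH[of "move x a" us] a * Cons.prems(1) move_V by auto
    moreover have "moves' x p = moves' (move x a) us" using *(1) \<phi>_move Cons.prems(1) a by auto
    ultimately have "a # w = (a # w1) @ w2 \<and> d (moves' x p) (moves x (a # w1)) \<le> c" by simp
    then show ?thesis by blast
  qed
qed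

section \<open>Paths between boundary vertices of a cone\<close>

lemma boundary_linked:
  "\<exists>\<rho>. \<forall>C \<in> cones X. \<forall>x \<in> cone_boundary X C. \<forall>y \<in> cone_boundary X C. \<forall>w.
    stays C x w \<longrightarrow> moves x w = y \<longrightarrow> d x y \<le> \<rho> \<and> linked {z \<in> V. d x z \<le> \<rho>} x (\<Phi> w) y"
proof -
  obtain D where D: "\<And>A w x y. A \<in> F \<Longrightarrow> w \<in> A \<Longrightarrow> x \<in> V \<Longrightarrow> links A x y \<Longrightarrow> d x y \<le> D"
    using links_dist_bound by metis
  \<comment> \<open>The polygon is a loop at \<open>base\<close>, while the geodesics end at
    \<open>root\<close>. Two fixed paths between these vertices prolong the geodesic sides, and
    their lengths are absorbed in \<open>c\<close>.\<close>
  obtain u0' v0' where uv0': "u0' \<in> lists S" "moves base u0' = root" "v0' \<in> lists S" "moves root v0' = base"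
    using reach_from base_V root_V by metis
  define u0 v0 where "u0 = \<Phi> u0'" and "v0 = \<Phi> v0'"
  have u0: "u0 \<in> lists S'" "moves' base u0 = root" and v0: "v0 \<in> lists S'" "moves' root v0 = base"
    unfolding u0_def v0_def using uv0' \<Phi>_S' moves'_\<Phi> base_V root_V by auto
  define c where "c = Max (insert (length (H u0)) (insert (length (H v0)) ((\<lambda>a. length (H (\<phi> a))) ` S)))"
  have c: "length (H (\<phi> a)) \<le> c" if "a \<in> S" for a
    unfolding c_def using finite_S that by (intro Max_ge) auto
  have cu: "length (H u0) \<le> c" and cv: "length (H v0) \<le> c"
    unfolding c_def using finite_S by (auto intro!: Max_ge simp del: Max_insert)
  \<comment> \<open>Suppose a diagonal leads from a cut point \<open>z\<close> to the geodesic
    \<open>u = u1 @ u2\<close> ending at \<open>x\<close>. Up to \<open>c\<close> and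
    \<open>D\<close> its other end is the vertex after \<open>u1\<close>, so \<open>d z root\<close>
    is at most \<open>D + c + length u1\<close>. As \<open>z\<close> is within \<open>c\<close> of
    the cone, \<open>d z root\<close> is also at least \<open>Suc n - c\<close>. Hence
    \<open>length u2\<close> is at most \<open>D + 2 * c\<close>, and going back to \<open>x\<close>
    along \<open>u2\<close> gives \<open>d x z\<close> at most \<open>2 * D + 3 * c\<close>. The
    side at \<open>y\<close> is symmetric.\<close>
  define r where "r = 2 * D + 3 * c"
  \<comment> \<open>A link of length at most \<open>D\<close> leaves the ball of radius
    \<open>r\<close> around \<open>x\<close> and must end within \<open>r\<close> of
    \<open>y\<close>, so \<open>d x y\<close> is at most \<open>2 * r + D\<close>. A cut point close
    to \<open>y\<close> is another \<open>r\<close> away from \<open>x\<close>.\<close>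
  have "d x y \<le> 3 * r + D \<and> linked {z \<in> V. d x z \<le> 3 * r + D} x (\<Phi> w) y"
    if C: "C \<in> cones X" and xy: "x \<in> cone_boundary X C" "y \<in> cone_boundary X C"
      and w: "stays C x w" "moves x w = y" for C x y w
  proof -
    obtain n x0 where n: "x0 \<in> far n" "C = component (far n) x0" "C \<subseteq> far n" "C \<subseteq> V"
      using coneE[OF C] by metis
    have V: "x \<in> V" "y \<in> V" using xy n by (auto simp: cone_boundary_def)
    have wS: "w \<in> lists S" using w staysD by blast
    have dx: "d x root = Suc n" "d y root = Suc n" using boundary_dist n xy by auto
    then obtain u v where u: "u \<in> lists S" "moves root u = x" "length u = Suc n"
      and v: "v \<in> lists S" "moves y v = root" "length v = Suc n"
      using dist_word root_V V dist_sym by metis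
    let ?u = "u0 @ \<Phi> u" and ?v = "\<Phi> v @ v0"
    have mu: "moves' base ?u = x" using u0 u root_V moves'_\<Phi> by simp
    have mw: "moves' x (\<Phi> w) = y" using w wS V moves'_\<Phi> by simp
    have mv: "moves' y ?v = base" using v0 v V moves'_\<Phi> by simp
    let ?A = "{w \<in> lists S'. moves' base w = base}"
    have "?u @ \<Phi> w @ ?v \<in> ?A"
    proof
      show "?u @ \<Phi> w @ ?v \<in> lists S' \<and> moves' base (?u @ \<Phi> w @ ?v) = base"
        using mu mw mv u0 v0 \<Phi>_S' u v wS by (simp add: foldl_append)
    qed
    then have "linked (cuts D base ?u (\<Phi> w) ?v) (moves' base ?u) (\<Phi> w) (moves' base (?u @ \<Phi> w))"
      by (intro linked_cuts[OF D loops, where x = base and y = base]) (auto simp: base_V links_def)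
    then have linked: "linked (cuts D base ?u (\<Phi> w) ?v) x (\<Phi> w) y"
      using mu mw by simp
    have cuts: "z \<in> V \<and> (d x z \<le> r \<or> d z y \<le> r)" if z: "z \<in> cuts D base ?u (\<Phi> w) ?v" for z
    proof -
      obtain w1 w2 where w12: "\<Phi> w = w1 @ w2" "z = moves' base (?u @ w1)"
        and or: "(\<exists>u1 u2. ?u = u1 @ u2 \<and> u2 \<noteq> [] \<and> d (moves' base u1) z \<le> D) \<or>
          (\<exists>v1 v2. ?v = v1 @ v2 \<and> v1 \<noteq> [] \<and> d z (moves' base (?u @ \<Phi> w @ v1)) \<le> D)"
        using z unfolding cuts_def by blast
      have w1S: "w1 \<in> lists S'" using \<Phi>_S'[OF wS] w12 by simp
      have zx: "z = moves' x w1" using w12(2) mu by simp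
      then have zV: "z \<in> V" using moves'_V V w1S by blast
      obtain w3 w4 where w34: "w = w3 @ w4" "d z (moves x w3) \<le> c"
        using prefix_near[OF c V(1) wS w12(1)] zx by blast
      have "moves x w3 \<in> C" using w(1) w34(1) unfolding stays_def by blast
      then have "Suc n \<le> d (moves x w3) root" "moves x w3 \<in> V" using n by (auto simp: far_def)
      \<comment> \<open>Only here is it used that \<open>w\<close> stays in the cone: its path
        avoids the ball of radius \<open>n\<close> around the root, and \<open>z\<close> is within
        \<open>c\<close> of the path.\<close>
      then have zr: "Suc n \<le> c + d z root"
        using dist_triangle[of "moves x w3" z root] dist_sym[of z "moves x w3"] w34 zV root_V by simp
      from or show ?thesis
      proof (elim disjE exE conjE)
        fix p q assume pq: "?u = p @ q" and dp: "d (moves' base p) z \<le> D"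
        let ?p = "moves' base p"
        have "?u \<in> lists S'" using u0 \<Phi>_S' u by simp
        then have pS: "p \<in> lists S'" using pq by simp
        have pV: "?p \<in> V" using moves'_V base_V pS by blast
        have "\<exists>u1 u2. u = u1 @ u2 \<and> d ?p (moves root u1) \<le> c"
        proof -
          obtain us where "u0 = p @ us \<and> us @ \<Phi> u = q \<or> u0 @ us = p \<and> \<Phi> u = us @ q"
            using pq by (auto simp: append_eq_append_conv2)
          then show ?thesis
          proof (elim disjE conjE)
            assume us: "u0 = p @ us"
            then have "moves' ?p us = root" "us \<in> lists S'" using u0 by auto
            then have "d ?p root \<le> length (H us)" using dist_moves' pV by blast
            also have "\<dots> \<le> c" using cu us by simp
            finally show ?thesis by - (rule exI[of _ "[]"], rule exI[of _ u], simp)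
          next
            assume us: "u0 @ us = p" "\<Phi> u = us @ q"
            then have "?p = moves' root us" using u0 by auto
            then show ?thesis using prefix_near[OF c root_V u(1) us(2)] by simp
          qed
        qed
        then obtain u1 u2 where u12: "u = u1 @ u2" "d ?p (moves root u1) \<le> c" by blast
        let ?m = "moves root u1"
        have mV: "?m \<in> V" using moves_V root_V u u12 by simp
        have "d root ?m \<le> length u1" "d ?m x \<le> length u2"
          using dist_le[of root u1 ?m] dist_le[of ?m u2 x] u u12 root_V mV by auto
        moreover have "length u1 + length u2 = Suc n" using u u12 by simp
        moreover have "d z root \<le> d z ?p + (d ?p ?m + d ?m root)"
          using dist_triangle[of z ?p root] dist_triangle[of ?p ?m root] zV pV mV root_V by simp
        moreover have "d x z \<le> d x ?m + (d ?m ?p + d ?p z)"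
          using dist_triangle[of x ?m z] dist_triangle[of ?m ?p z] zV pV mV V by simp
        moreover have "d z ?p = d ?p z" "d ?m root = d root ?m" "d x ?m = d ?m x" "d ?m ?p = d ?p ?m"
          using dist_sym zV pV mV root_V V by auto
        ultimately have "d x z \<le> r" unfolding r_def using zr dp u12(2) by linarith
        then show ?thesis using zV by blast
      next
        fix p q assume pq: "?v = p @ q" and dp: "d z (moves' base (?u @ \<Phi> w @ p)) \<le> D"
        let ?p = "moves' y p"
        have eq: "moves' base (?u @ \<Phi> w @ p) = ?p" using mu mw by (metis foldl_append)
        have "?v \<in> lists S'" using v0 \<Phi>_S' v by simp
        then have pS: "p \<in> lists S'" using pq by simp
        have pV: "?p \<in> V" using moves'_V V pS by blast
        have "\<exists>v1 v2. v = v1 @ v2 \<and> d ?p (moves y v1) \<le> c"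
        proof -
          obtain us where "\<Phi> v = p @ us \<and> us @ v0 = q \<or> \<Phi> v @ us = p \<and> v0 = us @ q"
            using pq by (auto simp: append_eq_append_conv2)
          then show ?thesis
          proof (elim disjE conjE)
            assume us: "\<Phi> v = p @ us"
            then show ?thesis using prefix_near[OF c V(2) v(1) us] by simp
          next
            assume us: "\<Phi> v @ us = p" "v0 = us @ q"
            then have "?p = moves' root us"
              by (simp only: us(1)[symmetric] foldl_append moves'_\<Phi>[OF V(2) v(1)] v(2))
            moreover have "us \<in> lists S'" using v0(1) us(2) by simp
            ultimately have "d root ?p \<le> length (H us)" using dist_moves' root_V by metis
            also have "\<dots> \<le> c" using cv us by simp
            finally have "d ?p root \<le> c" using dist_sym pV root_V by simp
            then show ?thesis using v by - (rule exI[of _ v], rule exI[of _ "[]"], simp)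
          qed
        qed
        then obtain v1 v2 where v12: "v = v1 @ v2" "d ?p (moves y v1) \<le> c" by blast
        let ?m = "moves y v1"
        have mV: "?m \<in> V" using moves_V V v v12 by simp
        have "d y ?m \<le> length v1" "d ?m root \<le> length v2"
          using dist_le[of y v1 ?m] dist_le[of ?m v2 root] v v12 V mV by auto
        moreover have "length v1 + length v2 = Suc n" using v v12 by simp
        moreover have "d z root \<le> d z ?p + (d ?p ?m + d ?m root)"
          using dist_triangle[of z ?p root] dist_triangle[of ?p ?m root] zV pV mV root_V by simp
        moreover have "d z y \<le> d z ?p + (d ?p ?m + d ?m y)"
          using dist_triangle[of z ?p y] dist_triangle[of ?p ?m y] zV pV mV V by simp
        moreover have "d ?m y = d y ?m"
          using dist_sym mV V by auto
        ultimately have "d z y \<le> r" unfolding r_def using zr dp[unfolded eq] v12(2) by linarith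
        then show ?thesis using zV by blast
      qed
    qed
    have dxy: "d x y \<le> 2 * r + D"
    proof (rule ccontr)
      assume "\<not> d x y \<le> 2 * r + D"
      then have far: "2 * r + D < d x y" by simp
      then have "\<exists>a \<in> V. \<exists>b \<in> V. d x a \<le> r \<and> \<not> d x b \<le> r \<and> (b \<in> cuts D base ?u (\<Phi> w) ?v \<or> b = y) \<and> d a b \<le> D"
        by (intro linked_jump[OF D linked V(1)]) (use V in auto)
      then obtain a b where ab: "a \<in> V" "b \<in> V" "d x a \<le> r" "\<not> d x b \<le> r" "d a b \<le> D"
        "b \<in> cuts D base ?u (\<Phi> w) ?v \<or> b = y" by blast
      then have "d b y \<le> r" using cuts V by auto
      then show False
        using far ab dist_triangle[of x a y] dist_triangle[of a b y] V by linarith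
    qed
    have "cuts D base ?u (\<Phi> w) ?v \<subseteq> {z \<in> V. d x z \<le> 3 * r + D}"
    proof
      fix z assume "z \<in> cuts D base ?u (\<Phi> w) ?v"
      then have z: "z \<in> V" "d x z \<le> r \<or> d z y \<le> r" using cuts by auto
      then show "z \<in> {z \<in> V. d x z \<le> 3 * r + D}"
        using dxy dist_triangle[of x y z] dist_sym[of z y] V by auto
    qed
    then show ?thesis using linked linked_mono dxy by auto
  qed
  then show ?thesis by blast
qed

section \<open>Cones with equal local data are isomorphic\<close>

text \<open>Vertices of the ball around \<open>x\<close> are named by words of length at most
  \<open>\<rho>\<close> read from \<open>x\<close>. All cut points lie in that ball, so the chain
  can be copied link by link to the vertices with the same names at \<open>x'\<close>. The
  assumption \<open>eq\<close> serves the empty chain, where one vertex may carry two names.\<close>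

lemma linked_transfer:
  assumes "linked Z a w b"
    and V: "x \<in> V" "x' \<in> V"
    and Z: "Z \<subseteq> {z \<in> V. d x z \<le> \<rho>}"
    and eq: "\<And>v v'. v \<in> lists S \<Longrightarrow> v' \<in> lists S \<Longrightarrow> length v \<le> \<rho> \<Longrightarrow> length v' \<le> \<rho> \<Longrightarrow>
      moves x v = moves x v' \<Longrightarrow> moves x' v = moves x' v'"
    and lk: "\<And>A v v'. A \<in> F \<Longrightarrow> v \<in> lists S \<Longrightarrow> v' \<in> lists S \<Longrightarrow> length v \<le> \<rho> \<Longrightarrow> length v' \<le> \<rho> \<Longrightarrow>
      links A (moves x v) (moves x v') \<Longrightarrow> links A (moves x' v) (moves x' v')"
    and v: "v \<in> lists S" "length v \<le> \<rho>" "a = moves x v"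
    and v': "v' \<in> lists S" "length v' \<le> \<rho>" "b = moves x v'"
  shows "moves' (moves x' v) w = moves x' v'"
  using assms(1) v v'
proof (induction arbitrary: v v' rule: linked.induct)
  case (empty a)
  then have "moves x v = moves x v'" by metis
  then show ?case using eq[OF empty(1,4,2,5)] by simp
next
  case (link A a b w)
  then have "links A (moves x' v) (moves x' v')" using lk by blast
  then show ?case using link.hyps(3) unfolding links_def by blast
next
  case (trans a u z w b)
  have "z \<in> V" "d x z \<le> \<rho>" using trans Z by auto
  then obtain v'' where "v'' \<in> lists S" "moves x v'' = z" "length v'' \<le> \<rho>"
    using dist_word V by metis
  then have "moves' (moves x' v) u = moves x' v''" "moves' (moves x' v'') w = moves x' v'"
    using trans.IH(1)[of v v''] trans.IH(2)[of v'' v'] trans.prems by blast+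
  then show ?case by simp
qed

theorem context_free_graph_X: "context_free_graph \<iota> X"
proof -
  obtain \<rho> where \<rho>: "\<And>C x y w. C \<in> cones X \<Longrightarrow> x \<in> cone_boundary X C \<Longrightarrow> y \<in> cone_boundary X C \<Longrightarrow>
    stays C x w \<Longrightarrow> moves x w = y \<Longrightarrow> d x y \<le> \<rho> \<and> linked {z \<in> V. d x z \<le> \<rho>} x (\<Phi> w) y"
    using boundary_linked by blast
  define B where "B k = {v \<in> lists S. length v \<le> k}" for k
  have finB: "finite (B k)" for k
    by (rule finite_subset[OF _ finite_lists_length_le[OF finite_S, of k]]) (auto simp: B_def)
  \<comment> \<open>The coincidences among short words, the short words ending in the cone, and the
    links between their ends. The second component goes to length \<open>Suc \<rho>\<close> in order
    to tell whether one more letter, read at a vertex of the ball, stays in the cone.\<close>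
  define tp where "tp C x = ({(v, v') \<in> B \<rho> \<times> B \<rho>. moves x v = moves x v'}, {v \<in> B (Suc \<rho>). moves x v \<in> C},
    {(A, v, v') \<in> F \<times> B \<rho> \<times> B \<rho>. links A (moves x v) (moves x v')})" for C x
  have tpD1: "moves x' v = moves x' v'"
    if tp: "tp C x = tp C' x'" and v: "v \<in> lists S" "v' \<in> lists S" "length v \<le> \<rho>" "length v' \<le> \<rho>"
      "moves x v = moves x v'" for C C' x x' v v'
  proof -
    have "(v, v') \<in> fst (tp C x)" using v unfolding tp_def B_def by simp
    then show ?thesis unfolding tp unfolding tp_def by simp
  qed
  have tpD2: "moves x' u \<in> C'"
    if tp: "tp C x = tp C' x'" and u: "u \<in> lists S" "length u \<le> Suc \<rho>" "moves x u \<in> C" for C C' x x' u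
  proof -
    have "u \<in> fst (snd (tp C x))" using u unfolding tp_def B_def by simp
    then show ?thesis unfolding tp unfolding tp_def by simp
  qed
  have tpD3: "links A (moves x' v) (moves x' v')"
    if tp: "tp C x = tp C' x'" and v: "A \<in> F" "v \<in> lists S" "v' \<in> lists S" "length v \<le> \<rho>"
      "length v' \<le> \<rho>" "links A (moves x v) (moves x v')" for C C' x x' v v' A
  proof -
    have "(A, v, v') \<in> snd (snd (tp C x))" using v unfolding tp_def B_def by simp
    then show ?thesis unfolding tp unfolding tp_def by simp
  qed
  have stays: "stays C' x' w"
    if tp: "tp C x = tp C' x'" and C: "C \<in> cones X" "C' \<in> cones X"
      and x: "x \<in> cone_boundary X C" "x' \<in> cone_boundary X C'" and w: "stays C x w" for C C' x x' w
    using w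
  proof (induction w rule: rev_induct)
    case Nil
    then show ?case using x by (simp add: cone_boundary_def)
  next
    case (snoc a w)
    have V: "x \<in> V" "x' \<in> V" using C x cone_subset by (auto simp: cone_boundary_def)
    have w: "stays C x w" "a \<in> S" "move (moves x w) a \<in> C" using snoc.prems stays_snoc by auto
    then have w': "stays C' x' w" using snoc.IH by simp
    show ?case
    proof (rule ccontr)
      assume "\<not> stays C' x' (w @ [a])"
      then have out: "move (moves x' w) a \<notin> C'" using w w' stays_snoc by blast
      let ?y' = "moves x' w"
      \<comment> \<open>The path leaves \<open>C'\<close> at \<open>?y'\<close>, so this is a
        boundary vertex and has a short name \<open>v\<close> at \<open>x'\<close>. Transferring
        back, \<open>w\<close> and \<open>v\<close> also lead to the same vertex from
        \<open>x\<close>, and then the type decides about \<open>v @ [a]\<close>.\<close>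
      have "?y' \<in> cone_boundary X C'"
        using cone_boundary_eq[OF cone_subset[OF C(2)]] staysD(3)[OF w'] w out by auto
      then have y': "d x' ?y' \<le> \<rho>" "linked {z \<in> V. d x' z \<le> \<rho>} x' (\<Phi> w) ?y'"
        using \<rho>[OF C(2) x(2) _ w'] by auto
      have y'V: "?y' \<in> V" using staysD(3)[OF w'] C cone_subset by blast
      obtain v where v: "v \<in> lists S" "moves x' v = ?y'" "length v \<le> \<rho>"
        using dist_word[OF V(2) y'V] y'(1) by metis
      have "moves' (moves x []) (\<Phi> w) = moves x v"
        by (rule linked_transfer[where \<rho> = \<rho>, OF y'(2) V(2,1) subset_refl])
          (rule tpD1[OF tp[symmetric]] tpD3[OF tp[symmetric]], assumption+ | simp add: v)+
      then have "moves x w = moves x v" using moves'_\<Phi> V staysD(1)[OF w'] by simp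
      then have "moves x (v @ [a]) \<in> C" using w by simp
      then have "moves x' (v @ [a]) \<in> C'" using tpD2[OF tp, of "v @ [a]"] v w by simp
      then show False using out v by simp
    qed
  qed
  have eq: "moves x' w1 = moves x' w2"
    if tp: "tp C x = tp C' x'" and C: "C \<in> cones X" "C' \<in> cones X"
      and x: "x \<in> cone_boundary X C" "x' \<in> cone_boundary X C'"
      and w: "stays C x w1" "stays C x w2" "moves x w1 = moves x w2" for C C' x x' w1 w2
  proof -
    have V: "x \<in> V" "x' \<in> V" using C x cone_subset by (auto simp: cone_boundary_def)
    have wS: "w1 \<in> lists S" "w2 \<in> lists S" using w staysD by auto
    \<comment> \<open>The common end of \<open>w1\<close> and \<open>w2\<close> may lie deep in the
      cone. Returning along \<open>w2\<close> makes a loop whose two ends are the boundary vertex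
      \<open>x\<close>, as the bound requires.\<close>
    let ?w = "w1 @ winv w2"
    have st: "stays C x ?w" using w stays_winv[OF cone_subset[OF C(1)] w(2)] stays_append by simp
    have cl: "moves x ?w = x" using moves_winv[OF V(1) wS(2)] w by simp
    have "linked {z \<in> V. d x z \<le> \<rho>} x (\<Phi> ?w) x"
      using \<rho>[OF C(1) x(1) x(1) st cl] by blast
    then have "moves' (moves x' []) (\<Phi> ?w) = moves x' []"
      by (rule linked_transfer[where \<rho> = \<rho>, OF _ V subset_refl])
        (rule tpD1[OF tp] tpD3[OF tp], assumption+ | simp)+
    then have "moves x' ?w = x'"
      using moves'_\<Phi>[OF V(2), of ?w] wS winv_S by simp
    moreover have "moves (moves x' ?w) w2 = moves x' w1"
    proof -
      have "moves x' w1 \<in> V" using moves_V V wS by blast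
      then have "moves (moves (moves x' w1) (winv w2)) (winv (winv w2)) = moves x' w1"
        using moves_winv winv_S wS by blast
      moreover have "winv (winv w2) = w2"
        using wS(2) by (auto simp: winv_def rev_map intro!: map_idI)
      ultimately show ?thesis by simp
    qed
    ultimately show ?thesis by simp
  qed
  have iso: "cone_iso X C C'"
    if tp: "tp C x = tp C' x'" and C: "C \<in> cones X" "C' \<in> cones X"
      and x: "x \<in> cone_boundary X C" "x' \<in> cone_boundary X C'" for C C' x x'
  proof -
    note st1 = stays[OF tp C x] and st2 = stays[OF tp[symmetric] C(2,1) x(2,1)]
    note eq1 = eq[OF tp C x] and eq2 = eq[OF tp[symmetric] C(2,1) x(2,1)]
    have V: "x \<in> V" "x' \<in> V" using C x cone_subset by (auto simp: cone_boundary_def)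
    have xC: "x \<in> C" "x' \<in> C'" using x by (auto simp: cone_boundary_def)
    \<comment> \<open>The isomorphism reads at \<open>x'\<close> a word leading from
      \<open>x\<close> to \<open>y\<close> inside \<open>C\<close>; by \<open>eq\<close> the result
      does not depend on the word chosen.\<close>
    define f where "f y = moves x' (SOME w. stays C x w \<and> moves x w = y)" for y
    have f: "f (moves x w) = moves x' w" if w: "stays C x w" for w
    proof -
      let ?w = "SOME w'. stays C x w' \<and> moves x w' = moves x w"
      have "stays C x ?w \<and> moves x ?w = moves x w" by (rule someI[of _ w]) (simp add: w)
      then show ?thesis unfolding f_def using eq1[of ?w w] w by blast
    qed
    have rep: "\<exists>w. stays C x w \<and> y = moves x w" if "y \<in> C" for y
      using cone_stays[OF C(1) xC(1) that] by metis
    have rep': "\<exists>w. stays C' x' w \<and> y = moves x' w" if "y \<in> C'" for y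
      using cone_stays[OF C(2) xC(2) that] by metis
    have step: "move (moves x w) a \<in> C \<longleftrightarrow> move (moves x' w) a \<in> C'" if "stays C x w" "a \<in> S" for w a
      using st1[of "w @ [a]"] st2[of "w @ [a]"] st1[OF that(1)] that by (auto simp: stays_snoc)
    show ?thesis
      unfolding cone_iso_def
    proof (intro exI[of _ f] conjI ballI allI)
      show "bij_betw f C C'"
        unfolding bij_betw_def
      proof
        show "inj_on f C"
        proof (rule inj_onI)
          fix y z assume "y \<in> C" "z \<in> C" "f y = f z"
          then obtain w1 w2 where "stays C x w1" "y = moves x w1" "stays C x w2" "z = moves x w2" "f y = f z"
            using rep by blast
          then show "y = z" using f st1 eq2 by metis
        qed
        have "f y \<in> C'" if "y \<in> C" for y using rep[OF that] f st1 staysD(3) by metis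
        moreover have "\<exists>z \<in> C. y = f z" if "y \<in> C'" for y using rep'[OF that] f st2 staysD(3) by metis
        ultimately show "f ` C = C'" by blast
      qed
      have "y \<in> cone_boundary X C \<longleftrightarrow> f y \<in> cone_boundary X C'" if y: "y \<in> C" for y
      proof -
        obtain w where w: "stays C x w" "y = moves x w" using rep y by blast
        have "f y \<in> C'" using f w st1 staysD(3) by metis
        then show ?thesis
          using step[OF w(1)] y w f
          unfolding cone_boundary_eq[OF cone_subset[OF C(1)]] cone_boundary_eq[OF cone_subset[OF C(2)]] by auto
      qed
      moreover have "f ` C = C'" using \<open>bij_betw f C C'\<close> by (simp add: bij_betw_def)
      moreover have "cone_boundary X C \<subseteq> C" "cone_boundary X C' \<subseteq> C'" by (auto simp: cone_boundary_def)
      ultimately show "f ` cone_boundary X C = cone_boundary X C'" by blast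
      fix y z a assume y: "y \<in> C" and z: "z \<in> C"
      obtain w where w: "stays C x w" "y = moves x w" using rep y by blast
      obtain w' where w': "stays C x w'" "z = moves x w'" using rep z by blast
      have yV: "y \<in> V" "f y \<in> V" using y cone_subset C \<open>f ` C = C'\<close> by blast+
      have "z = move y a \<longleftrightarrow> f z = move (f y) a" if a: "a \<in> S"
      proof
        assume "z = move y a"
        then have "stays C x (w @ [a])" "z = moves x (w @ [a])" using w z a stays_snoc by auto
        then show "f z = move (f y) a" using f[of "w @ [a]"] f[of w] w by simp
      next
        assume e: "f z = move (f y) a"
        then have "move (moves x' w) a = moves x' w'" using f w w' by simp
        moreover have "moves x' w' \<in> C'" using st1 staysD(3) w' by blast
        ultimately have "move (moves x w) a \<in> C" using step w a by simp
        then have st: "stays C x (w @ [a])" using w a stays_snoc by simp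
        have "moves x (w @ [a]) = moves x w'"
          using eq2[OF st1[OF st] st1[OF w'(1)]] \<open>move (moves x' w) a = moves x' w'\<close> by simp
        then show "z = move y a" using w w' by simp
      qed
      then show "(y, a, z) \<in> graph_edges X \<longleftrightarrow> (f y, a, f z) \<in> graph_edges X"
        using yV edge_X by blast
    qed
  qed
  define b where "b C = (SOME x. x \<in> cone_boundary X C)" for C
  have b: "b C \<in> cone_boundary X C" if "C \<in> cones X" for C
    unfolding b_def using cone_boundary_nonempty[OF that] by (simp add: some_in_eq)
  let ?T = "Pow (B \<rho> \<times> B \<rho>) \<times> Pow (B (Suc \<rho>)) \<times> Pow (F \<times> B \<rho> \<times> B \<rho>)"
  show ?thesis
  proof (rule context_free_graphI[of ?T "\<lambda>C. tp C (b C)"])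
    show "finite ?T" using finB family by (simp add: splitting_family_def)
    show "tp C (b C) \<in> ?T" for C unfolding tp_def by auto
    show "cone_iso X C D" if "C \<in> cones X" "D \<in> cones X" "tp C (b C) = tp D (b D)" for C D
      using iso[OF that(3,1,2)] b that by blast
  qed
qed

end

section \<open>Automata from context-free graphs\<close>

text \<open>Deterministic languages are defined with automata over natural numbers, whereas the
  automaton built from a graph has vertices as states and cones as stack symbols.\<close>

definition rename_pda :: "('q \<Rightarrow> 'p) \<Rightarrow> ('z \<Rightarrow> 'y) \<Rightarrow> ('q, 'a, 'z) pda \<Rightarrow> ('p, 'a, 'y) pda" where
  "rename_pda f g M =
     \<lparr> pda_states = f ` pda_states M, pda_alphabet = pda_alphabet M,
       pda_stack_symbols = g ` pda_stack_symbols M,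
       pda_trans = (\<lambda>p a z. (\<lambda>(q, u). (f q, map g u)) `
         pda_trans M (inv_into (pda_states M) f p) a (map_option (inv_into (pda_stack_symbols M) g) z)),
       pda_start = f (pda_start M), pda_final = f ` pda_final M,
       pda_start_symbol = g (pda_start_symbol M) \<rparr>"

lemma stack_top_in: "s \<in> lists Z \<Longrightarrow> stack_top s \<in> insert None (Some ` Z)"
  using last_in_set[of s] by (auto simp: stack_top_def)

lemma pda_step_closed:
  assumes "pda M" "pda_step M (p, w, s) (q, w', s')" "p \<in> pda_states M" "w \<in> lists (pda_alphabet M)"
    "s \<in> lists (pda_stack_symbols M)"
  shows "q \<in> pda_states M \<and> w' \<in> lists (pda_alphabet M) \<and> s' \<in> lists (pda_stack_symbols M)"
proof -
  note top = stack_top_in[OF assms(5)]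
  have bl: "butlast s \<in> lists (pda_stack_symbols M)" using assms(5) by (auto dest: in_set_butlastD)
  have tr: "q \<in> pda_states M \<and> u \<in> lists (pda_stack_symbols M)"
    if "(q, u) \<in> pda_trans M p a (stack_top s)" "a \<in> insert None (Some ` pda_alphabet M)" for q u a
    using pda_transD[OF assms(1,3) that(2) top that(1)] by blast
  from assms(2) show ?thesis
  proof cases
    case (read u a)
    then have "q \<in> pda_states M \<and> u \<in> lists (pda_stack_symbols M)" using assms(4) by (intro tr[of _ _ "Some a"]) auto
    then show ?thesis using read bl assms(4) by auto
  next
    case (silent u)
    then have "q \<in> pda_states M \<and> u \<in> lists (pda_stack_symbols M)" by (intro tr[of _ _ None]) auto
    then show ?thesis using silent bl assms(4) by auto
  qed
qed

locale pda_renaming =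
  fixes f :: "'q \<Rightarrow> 'p" and g :: "'z \<Rightarrow> 'y" and M :: "('q, 'a, 'z) pda"
  assumes M: "pda M" and f: "inj_on f (pda_states M)" and g: "inj_on g (pda_stack_symbols M)"
begin

abbreviation "M' \<equiv> rename_pda f g M"

lemma trans_rename:
  assumes "p \<in> pda_states M" "z \<in> insert None (Some ` pda_stack_symbols M)"
  shows "pda_trans M' (f p) a (map_option g z) = (\<lambda>(q, u). (f q, map g u)) ` pda_trans M p a z"
proof -
  have "map_option (inv_into (pda_stack_symbols M) g) (map_option g z) = z"
    using assms(2) g by auto
  then show ?thesis using assms(1) f by (simp add: rename_pda_def)
qed

lemma stack_top_map: "stack_top (map g s) = map_option g (stack_top s)"
  by (simp add: stack_top_def last_map)

lemma rename_step:
  assumes "p \<in> pda_states M" "s \<in> lists (pda_stack_symbols M)"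
  shows "pda_step M' (f p, w, map g s) c \<longleftrightarrow>
    (\<exists>q w' s'. c = (f q, w', map g s') \<and> pda_step M (p, w, s) (q, w', s'))"
proof
  note tr = trans_rename[OF assms(1) stack_top_in[OF assms(2)]]
  assume "pda_step M' (f p, w, map g s) c"
  then show "\<exists>q w' s'. c = (f q, w', map g s') \<and> pda_step M (p, w, s) (q, w', s')"
  proof cases
    case (read q u a w')
    then obtain q' u' where "q = f q'" "u = map g u'" "(q', u') \<in> pda_trans M p (Some a) (stack_top s)"
      unfolding stack_top_map tr by auto
    then show ?thesis using read
      by (intro exI[of _ q'] exI[of _ w'] exI[of _ "butlast s @ u'"]) (auto simp: map_butlast intro: pda_step.read)
  next
    case (silent q u)
    then obtain q' u' where "q = f q'" "u = map g u'" "(q', u') \<in> pda_trans M p None (stack_top s)"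
      unfolding stack_top_map tr by auto
    then show ?thesis using silent
      by (intro exI[of _ q'] exI[of _ w] exI[of _ "butlast s @ u'"]) (auto simp: map_butlast intro: pda_step.silent)
  qed
next
  note tr = trans_rename[OF assms(1) stack_top_in[OF assms(2)]]
  assume "\<exists>q w' s'. c = (f q, w', map g s') \<and> pda_step M (p, w, s) (q, w', s')"
  then obtain q w' s' where c: "c = (f q, w', map g s')" and st: "pda_step M (p, w, s) (q, w', s')" by blast
  from st show "pda_step M' (f p, w, map g s) c"
  proof cases
    case (read u a)
    have "(f q, map g u) \<in> pda_trans M' (f p) (Some a) (stack_top (map g s))"
      unfolding stack_top_map tr using read by force
    from pda_step.read[OF this, of w'] show ?thesis using read c by (simp add: map_butlast)
  next
    case (silent u)
    have "(f q, map g u) \<in> pda_trans M' (f p) None (stack_top (map g s))"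
      unfolding stack_top_map tr using silent by force
    from pda_step.silent[OF this, of w'] show ?thesis using silent c by (simp add: map_butlast)
  qed
qed

lemma rename_run:
  assumes "p \<in> pda_states M" "w \<in> lists (pda_alphabet M)" "s \<in> lists (pda_stack_symbols M)"
  shows "(pda_step M')\<^sup>*\<^sup>* (f p, w, map g s) c \<longleftrightarrow>
    (\<exists>q w' s'. c = (f q, w', map g s') \<and> (pda_step M)\<^sup>*\<^sup>* (p, w, s) (q, w', s') \<and>
      q \<in> pda_states M \<and> w' \<in> lists (pda_alphabet M) \<and> s' \<in> lists (pda_stack_symbols M))"
proof
  assume "(pda_step M')\<^sup>*\<^sup>* (f p, w, map g s) c"
  then show "\<exists>q w' s'. c = (f q, w', map g s') \<and> (pda_step M)\<^sup>*\<^sup>* (p, w, s) (q, w', s') \<and>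
      q \<in> pda_states M \<and> w' \<in> lists (pda_alphabet M) \<and> s' \<in> lists (pda_stack_symbols M)"
  proof (induction rule: rtranclp_induct)
    case base
    then show ?case using assms by blast
  next
    case (step c c')
    then obtain q w' s' where c: "c = (f q, w', map g s')" "(pda_step M)\<^sup>*\<^sup>* (p, w, s) (q, w', s')"
      "q \<in> pda_states M" "w' \<in> lists (pda_alphabet M)" "s' \<in> lists (pda_stack_symbols M)" by blast
    then obtain q2 w2 s2 where c': "c' = (f q2, w2, map g s2)" "pda_step M (q, w', s') (q2, w2, s2)"
      using step(2) rename_step by blast
    then show ?case using c pda_step_closed[OF M c'(2)] by (blast intro: rtranclp.rtrancl_into_rtrancl)
  qed
next
  assume "\<exists>q w' s'. c = (f q, w', map g s') \<and> (pda_step M)\<^sup>*\<^sup>* (p, w, s) (q, w', s') \<and>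
      q \<in> pda_states M \<and> w' \<in> lists (pda_alphabet M) \<and> s' \<in> lists (pda_stack_symbols M)"
  then obtain q w' s' where c: "c = (f q, w', map g s')" and run: "(pda_step M)\<^sup>*\<^sup>* (p, w, s) (q, w', s')" by blast
  from run have "(pda_step M')\<^sup>*\<^sup>* (f p, w, map g s) (f q, w', map g s') \<and> q \<in> pda_states M \<and>
      w' \<in> lists (pda_alphabet M) \<and> s' \<in> lists (pda_stack_symbols M)"
  proof (induction "(q, w', s')" arbitrary: q w' s' rule: rtranclp_induct)
    case base
    then show ?case using assms by blast
  next
    case (step c2)
    obtain q2 w2 s2 where c2: "c2 = (q2, w2, s2)" by (cases c2)
    have IH: "(pda_step M')\<^sup>*\<^sup>* (f p, w, map g s) (f q2, w2, map g s2)" "q2 \<in> pda_states M"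
      "w2 \<in> lists (pda_alphabet M)" "s2 \<in> lists (pda_stack_symbols M)" using step.hyps(3)[OF c2] by auto
    have "pda_step M' (f q2, w2, map g s2) (f q, w', map g s')"
      using rename_step[OF IH(2,4)] step.hyps(2) c2 by blast
    then show ?case
      using IH pda_step_closed[OF M _ IH(2-4)] step.hyps(2) c2 by (blast intro: rtranclp.rtrancl_into_rtrancl)
  qed
  then show "(pda_step M')\<^sup>*\<^sup>* (f p, w, map g s) c" using c by blast
qed

lemma rename_language: "pda_language M' = pda_language M"
proof -
  have s: "pda_start M \<in> pda_states M" "[pda_start_symbol M] \<in> lists (pda_stack_symbols M)"
    "pda_final M \<subseteq> pda_states M"
    using M unfolding pda_def by auto
  have "(\<exists>q \<in> pda_final M'. (pda_step M')\<^sup>*\<^sup>* (pda_start M', w, [pda_start_symbol M']) (q, [], [])) \<longleftrightarrow>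
     (\<exists>q \<in> pda_final M. (pda_step M)\<^sup>*\<^sup>* (pda_start M, w, [pda_start_symbol M]) (q, [], []))" (is "?l \<longleftrightarrow> ?r")
    if w: "w \<in> lists (pda_alphabet M)" for w
  proof
    assume ?l
    then obtain q where q: "q \<in> pda_final M"
      "(pda_step M')\<^sup>*\<^sup>* (f (pda_start M), w, map g [pda_start_symbol M]) (f q, [], [])"
      by (auto simp: rename_pda_def)
    then obtain q' where "f q = f q'" "q' \<in> pda_states M"
      "(pda_step M)\<^sup>*\<^sup>* (pda_start M, w, [pda_start_symbol M]) (q', [], [])"
      using rename_run[OF s(1) w s(2)] by auto
    then show ?r using q(1) s(3) f by (metis inj_onD subsetD)
  next
    assume ?r
    then obtain q where q: "q \<in> pda_final M"
      "(pda_step M)\<^sup>*\<^sup>* (pda_start M, w, [pda_start_symbol M]) (q, [], [])" by blast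
    then have "(pda_step M')\<^sup>*\<^sup>* (f (pda_start M), w, map g [pda_start_symbol M]) (f q, [], [])"
      using rename_run[OF s(1) w s(2)] s(3) by auto
    then show ?l using q(1) by (auto simp: rename_pda_def)
  qed
  moreover have "pda_alphabet M' = pda_alphabet M" by (simp add: rename_pda_def)
  ultimately show ?thesis unfolding pda_language_def by auto
qed

lemma rename_deterministic:
  assumes "deterministic_pda M"
  shows "deterministic_pda M'"
proof -
  note [simp] = rename_pda_def
  have syms: "pda_stack_symbols M' = g ` pda_stack_symbols M" by simp
  have z': "\<exists>z' \<in> insert None (Some ` pda_stack_symbols M). z = map_option g z'"
    if "z \<in> insert None (Some ` g ` pda_stack_symbols M)" for z
    using that by auto
  have fin: "finite (pda_trans M p a z) \<and> pda_trans M p a z \<subseteq> pda_states M \<times> lists (pda_stack_symbols M)"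
    if "p \<in> pda_states M" "a \<in> insert None (Some ` pda_alphabet M)"
      "z \<in> insert None (Some ` pda_stack_symbols M)" for p a z
    using M that unfolding pda_def by blast
  have "pda M'"
    unfolding pda_def
  proof (intro conjI ballI)
    fix p a z
    assume p: "p \<in> pda_states M'" and a: "a \<in> insert None (Some ` pda_alphabet M')"
      and z: "z \<in> insert None (Some ` pda_stack_symbols M')"
    obtain p' where p': "p = f p'" "p' \<in> pda_states M" using p by auto
    obtain z' where z': "z' \<in> insert None (Some ` pda_stack_symbols M)" "z = map_option g z'"
      using z'[of z] z unfolding syms by blast
    have tr: "pda_trans M' p a z = (\<lambda>(q, u). (f q, map g u)) ` pda_trans M p' a z'"
      using trans_rename[OF p'(2) z'(1)] p' z' by simp
    have F: "finite (pda_trans M p' a z')" "pda_trans M p' a z' \<subseteq> pda_states M \<times> lists (pda_stack_symbols M)"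
      using fin[OF p'(2) _ z'(1), of a] a by auto
    show "finite (pda_trans M' p a z)" unfolding tr using F by blast
    show "pda_trans M' p a z \<subseteq> pda_states M' \<times> lists (pda_stack_symbols M')" unfolding tr using F by fastforce
  next
    have "finite (pda_states M)" "finite (pda_alphabet M)" "finite (pda_stack_symbols M)"
      "pda_start M \<in> pda_states M" "pda_final M \<subseteq> pda_states M" "pda_start_symbol M \<in> pda_stack_symbols M"
      using M unfolding pda_def by blast+
    then show "finite (pda_states M')" "finite (pda_alphabet M')" "finite (pda_stack_symbols M')"
      "pda_start M' \<in> pda_states M'" "pda_final M' \<subseteq> pda_states M'"
      "pda_start_symbol M' \<in> pda_stack_symbols M'"
      by (auto simp: rename_pda_def)
  qed
  moreover have "card (pda_trans M' p (Some a) z) + card (pda_trans M' p None z) \<le> 1"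
    if paz: "p \<in> pda_states M'" "a \<in> pda_alphabet M'" "z \<in> insert None (Some ` pda_stack_symbols M')" for p a z
  proof -
    obtain p' where p': "p = f p'" "p' \<in> pda_states M" using paz(1) by auto
    obtain z' where z': "z' \<in> insert None (Some ` pda_stack_symbols M)" "z = map_option g z'"
      using z'[of z] paz(3) unfolding syms by blast
    have a: "a \<in> pda_alphabet M" using paz(2) by simp
    have "card (pda_trans M' p b z) \<le> card (pda_trans M p' b z')" if "b \<in> {Some a, None}" for b
      unfolding p' z' trans_rename[OF p'(2) z'(1)] using fin[OF p'(2) _ z'(1), of b] that a
      by (intro card_image_le) auto
    then have "card (pda_trans M' p (Some a) z) + card (pda_trans M' p None z) \<le>
        card (pda_trans M p' (Some a) z') + card (pda_trans M p' None z')"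
      by (intro add_mono) auto
    also have "\<dots> \<le> 1" using assms p' z' a unfolding deterministic_pda_def by blast
    finally show ?thesis .
  qed
  ultimately show ?thesis unfolding deterministic_pda_def by blast
qed

end

lemma deterministic_pda_language:
  fixes M :: "('q, 'a, 'z) pda"
  assumes "deterministic_pda M"
  shows "deterministic_context_free_language (pda_alphabet M) (pda_language M)"
proof -
  have M: "pda M" using assms unfolding deterministic_pda_def by blast
  then have "finite (pda_states M)" "finite (pda_stack_symbols M)" unfolding pda_def by auto
  then obtain f :: "'q \<Rightarrow> nat" and g :: "'z \<Rightarrow> nat"
    where "inj_on f (pda_states M)" "inj_on g (pda_stack_symbols M)"
    using finite_imp_inj_to_nat_seg by metis
  then interpret pda_renaming f g M using M by unfold_locales
  show ?thesis
    unfolding deterministic_context_free_language_def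
    using rename_deterministic[OF assms] rename_language
    by (intro exI[of _ M']) (simp add: rename_pda_def)
qed

context complete_symmetric_graph
begin

section \<open>Representatives of cone types and the geometry of the stack\<close>

text \<open>The choice is made from the class of \<open>C\<close> as a set, so isomorphic cones
  share their representative, and finitely many types leave finitely many representatives.\<close>

definition rep :: "'v set \<Rightarrow> 'v set" where
  "rep C = (SOME D. D \<in> cone_rel `` {C})"

definition emb :: "'v set \<Rightarrow> 'v \<Rightarrow> 'v" where
  "emb C = (SOME f. bij_betw f (rep C) C \<and>
     (\<forall>x \<in> rep C. \<forall>y \<in> rep C. \<forall>a. (x, a, y) \<in> graph_edges X \<longleftrightarrow> (f x, a, f y) \<in> graph_edges X) \<and>
     f ` cone_boundary X (rep C) = cone_boundary X C)"

lemma rep: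
  assumes "C \<in> cones X"
  shows "rep C \<in> cones X" "cone_iso X C (rep C)"
proof -
  have "C \<in> cone_rel `` {C}" using assms cone_iso_refl by simp
  then have "rep C \<in> cone_rel `` {C}" unfolding rep_def by (rule someI)
  then show "rep C \<in> cones X" "cone_iso X C (rep C)" by auto
qed

lemma emb:
  assumes "C \<in> cones X"
  shows "bij_betw (emb C) (rep C) C" "emb C ` cone_boundary X (rep C) = cone_boundary X C"
    "x \<in> rep C \<Longrightarrow> y \<in> rep C \<Longrightarrow> a \<in> S \<Longrightarrow> emb C y = move (emb C x) a \<longleftrightarrow> y = move x a"
proof -
  have "cone_iso X (rep C) C" using rep[OF assms] cone_iso_sym by blast
  then have *: "bij_betw (emb C) (rep C) C \<and>
     (\<forall>x \<in> rep C. \<forall>y \<in> rep C. \<forall>a. (x, a, y) \<in> graph_edges X \<longleftrightarrow> (emb C x, a, emb C y) \<in> graph_edges X) \<and>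
     emb C ` cone_boundary X (rep C) = cone_boundary X C"
    unfolding cone_iso_def emb_def by (rule someI_ex)
  then show "bij_betw (emb C) (rep C) C" "emb C ` cone_boundary X (rep C) = cone_boundary X C" by auto
  assume x: "x \<in> rep C" "y \<in> rep C" "a \<in> S"
  then have "x \<in> V" "emb C x \<in> V"
    using * rep[OF assms] cone_subset assms unfolding bij_betw_def by blast+
  moreover have "(x, a, y) \<in> graph_edges X \<longleftrightarrow> (emb C x, a, emb C y) \<in> graph_edges X" using * x by blast
  ultimately show "emb C y = move (emb C x) a \<longleftrightarrow> y = move x a" using x by (simp add: edge_X)
qed

lemma finite_reps:
  assumes "context_free_graph \<iota> X"
  shows "finite (rep ` cones X)"
proof -
  have "rep ` cones X \<subseteq> (\<lambda>c. SOME D. D \<in> c) ` (cones X // cone_rel)"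
  proof
    fix R assume "R \<in> rep ` cones X"
    then obtain C where "C \<in> cones X" "R = rep C" by blast
    then show "R \<in> (\<lambda>c. SOME D. D \<in> c) ` (cones X // cone_rel)"
      unfolding rep_def by (intro image_eqI[of _ _ "cone_rel `` {C}"] quotientI)
  qed
  then show ?thesis using assms finite_surj unfolding context_free_graph_def by blast
qed

text \<open>A frame is what the top of the stack stands for. The empty stack, \<open>None\<close>,
  stands for the whole graph, with the root in the role of a boundary; a cone stands for its
  representative.\<close>

definition region :: "'v set option \<Rightarrow> 'v set" where
  "region z = (case z of None \<Rightarrow> V | Some C \<Rightarrow> rep C)"

definition rim :: "'v set option \<Rightarrow> 'v set" where
  "rim z = (case z of None \<Rightarrow> {root} | Some C \<Rightarrow> cone_boundary X (rep C))"

abbreviation frames :: "'v set option set" where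
  "frames \<equiv> insert None (Some ` cones X)"

text \<open>The last two claims allow frames to be stacked: a step from a vertex off the rim cannot
  leave the region, and the components beyond the rim are cones, hence have representatives of their
  own.\<close>

lemma frame:
  assumes "z \<in> frames"
  shows "region z \<subseteq> V" "rim z \<subseteq> region z" "finite (rim z)"
    "x \<in> region z - rim z \<Longrightarrow> a \<in> S \<Longrightarrow> move x a \<in> region z"
    "x \<in> region z - rim z \<Longrightarrow> component (region z - rim z) x \<in> cones X"
proof -
  from assms consider "z = None" | C where "z = Some C" "C \<in> cones X" by blast
  then have "region z \<subseteq> V \<and> rim z \<subseteq> region z \<and> finite (rim z) \<and>
    (\<forall>x a. x \<in> region z - rim z \<longrightarrow> a \<in> S \<longrightarrow> move x a \<in> region z) \<and>
    (\<forall>x. x \<in> region z - rim z \<longrightarrow> component (region z - rim z) x \<in> cones X)"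
  proof cases
    case 1
    then show ?thesis
      using root_V move_V component_minus_root by (simp add: region_def rim_def)
  next
    case 2
    have R: "rep C \<in> cones X" using rep 2 by blast
    then show ?thesis
      using 2 cone_subset[OF R] finite_cone_boundary[OF R] component_minus_boundary[OF R]
        cone_boundary_eq[OF cone_subset[OF R]]
      by (auto simp: region_def rim_def)
  qed
  then show "region z \<subseteq> V" "rim z \<subseteq> region z" "finite (rim z)"
    "x \<in> region z - rim z \<Longrightarrow> a \<in> S \<Longrightarrow> move x a \<in> region z"
    "x \<in> region z - rim z \<Longrightarrow> component (region z - rim z) x \<in> cones X" by blast+
qed

text \<open>The stack records nested cones, each one inside the representative of the type of the one
  below it, and the state is a rim vertex of the topmost representative. Since a rim vertex is
  adjacent to no vertex beyond the rim of the next representative below, one letter changes the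
  height of the stack by at most one.\<close>

definition frame_move :: "'v set option \<Rightarrow> 'v \<Rightarrow> 'a \<Rightarrow> 'v \<times> 'v set list" where
  "frame_move z x a =
    (let y = move x a; keep = (case z of None \<Rightarrow> [] | Some C \<Rightarrow> [C]);
         C' = component (region z - rim z) y
     in if y \<in> rim z then (y, keep)
        else if y \<in> region z then (inv_into (rep C') (emb C') y, keep @ [C'])
        else (move (emb (the z) x) a, []))"

text \<open>This is the stack alphabet. \<open>frames\<close> may be infinite, but only finitely
  many pairs of region and rim occur; rims are finite, and a cone is pushed only when one letter
  leads into it from a rim vertex.\<close>

definition stack_cones :: "'v set set" where
  "stack_cones = (\<Union>(R, B) \<in> (\<lambda>z. (region z, rim z)) ` frames.
     (\<lambda>(x, a). component (R - B) (move x a)) ` (B \<times> S))"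

definition rims :: "'v set" where "rims = \<Union> (rim ` frames)"

lemma finite_frames:
  assumes "context_free_graph \<iota> X"
  shows "finite ((\<lambda>z. (region z, rim z)) ` frames)"
proof -
  have "(\<lambda>z. (region z, rim z)) ` frames \<subseteq>
      insert (V, {root}) ((\<lambda>R. (R, cone_boundary X R)) ` rep ` cones X)"
  proof (intro image_subsetI)
    fix z assume "z \<in> frames"
    then show "(region z, rim z) \<in> insert (V, {root}) ((\<lambda>R. (R, cone_boundary X R)) ` rep ` cones X)"
      by (cases z) (simp_all add: region_def rim_def image_iff, blast)
  qed
  then show ?thesis by (rule finite_subset) (simp add: finite_reps[OF assms])
qed

lemma finite_rims:
  assumes "context_free_graph \<iota> X"
  shows "finite rims"
proof -
  have "rims = \<Union> (snd ` (\<lambda>z. (region z, rim z)) ` frames)" unfolding rims_def by auto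
  moreover have "finite (\<Union> (snd ` (\<lambda>z. (region z, rim z)) ` frames))"
    using finite_frames[OF assms] frame(3) by (intro finite_Union) auto
  ultimately show ?thesis by simp
qed

lemma finite_stack_cones:
  assumes "context_free_graph \<iota> X"
  shows "finite stack_cones"
  unfolding stack_cones_def
proof (rule finite_UN_I[OF finite_frames[OF assms]])
  fix p assume "p \<in> (\<lambda>z. (region z, rim z)) ` frames"
  then obtain z where "z \<in> frames" "p = (region z, rim z)" by blast
  then show "finite (case p of (R, B) \<Rightarrow> (\<lambda>(x, a). component (R - B) (move x a)) ` (B \<times> S))"
    using frame(3) finite_S by simp
qed

text \<open>The invariant of the automaton. A stacked cone lies in the region of the frame below,
  usually a representative and not its true place in the graph; \<open>h\<close> composes the
  embeddings along the stack, so in state \<open>x\<close> the current vertex of the graph is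
  \<open>h x\<close>.\<close>

inductive located :: "'v set list \<Rightarrow> ('v \<Rightarrow> 'v) \<Rightarrow> bool" where
  bottom: "located [] id"
| push: "located st h \<Longrightarrow> x \<in> region (stack_top st) - rim (stack_top st) \<Longrightarrow>
    C = component (region (stack_top st) - rim (stack_top st)) x \<Longrightarrow> C \<in> stack_cones \<Longrightarrow>
    located (st @ [C]) (h \<circ> emb C)"

lemma stack_top_snoc [simp]: "stack_top (st @ [C]) = Some C" "stack_top [] = None"
  by (simp_all add: stack_top_def)

lemma located_Nil [simp]: "located [] h \<longleftrightarrow> h = id"
  by (subst located.simps) simp

lemma located_frame: "located st h \<Longrightarrow> stack_top st \<in> frames"
  by (induction rule: located.induct) (use frame(5) in auto)

text \<open>Each embedding preserves the edges inside a representative, so moves within the top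
  region are true moves. The lowest cone avoids the root, so a nonempty stack means that the current
  vertex is not the root; this is why acceptance with empty stack detects loops.\<close>

lemma located_move:
  assumes "located st h"
  shows "x \<in> region (stack_top st) \<Longrightarrow> a \<in> S \<Longrightarrow> move x a \<in> region (stack_top st) \<Longrightarrow> h (move x a) = move (h x) a"
    and "x \<in> region (stack_top st) \<Longrightarrow> st \<noteq> [] \<Longrightarrow> h x \<noteq> root"
proof -
  have "(\<forall>x a. x \<in> region (stack_top st) \<longrightarrow> a \<in> S \<longrightarrow> move x a \<in> region (stack_top st) \<longrightarrow> h (move x a) = move (h x) a) \<and>
    (\<forall>x. x \<in> region (stack_top st) \<longrightarrow> st \<noteq> [] \<longrightarrow> h x \<noteq> root)"
    using assms
  proof (induction rule: located.induct)
    case bottom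
    then show ?case by simp
  next
    case (push st h x0 C)
    let ?z = "stack_top st"
    have z: "?z \<in> frames" using located_frame[OF push.hyps(1)] .
    have C: "C \<in> cones X" using frame(5)[OF z push.hyps(2)] push.hyps(3) by simp
    have sub: "C \<subseteq> region ?z - rim ?z" using component_subset push by metis
    have e: "emb C y \<in> C" if "y \<in> rep C" for y using emb(1)[OF C] that by (auto simp: bij_betw_def)
    have "h (emb C (move y a)) = move (h (emb C y)) a" if "y \<in> rep C" "a \<in> S" "move y a \<in> rep C" for y a
      using push.IH e[OF that(1)] e[OF that(3)] emb(3)[OF C that(1,3,2)] sub that by auto
    moreover have "h (emb C y) \<noteq> root" if "y \<in> rep C" for y
    proof (cases "st = []")
      case True
      then show ?thesis using push.hyps(1) e[OF that] sub by (auto simp: rim_def)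
    next
      case False
      then show ?thesis using push.IH e[OF that] sub by blast
    qed
    ultimately show ?case by (simp add: region_def)
  qed
  then show "x \<in> region (stack_top st) \<Longrightarrow> a \<in> S \<Longrightarrow> move x a \<in> region (stack_top st) \<Longrightarrow> h (move x a) = move (h x) a"
    and "x \<in> region (stack_top st) \<Longrightarrow> st \<noteq> [] \<Longrightarrow> h x \<noteq> root" by blast+
qed

lemma located_cones: "located st h \<Longrightarrow> st \<in> lists stack_cones"
  by (induction rule: located.induct) auto

lemma frame_move_located:
  assumes st: "located st h" and x: "x \<in> rim (stack_top st)" and a: "a \<in> S"
    and fm: "frame_move (stack_top st) x a = (x', u)"
  shows "\<exists>h'. located (butlast st @ u) h' \<and> x' \<in> rim (stack_top (butlast st @ u)) \<and> h' x' = move (h x) a \<and>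
    u \<in> lists stack_cones"
proof -
  let ?z = "stack_top st" and ?y = "move x a"
  have z: "?z \<in> frames" using located_frame[OF st] .
  have xd: "x \<in> region ?z" using frame(2)[OF z] x by blast
  then have xV: "x \<in> V" using frame(1)[OF z] by blast
  have keep: "butlast st @ (case ?z of None \<Rightarrow> [] | Some C \<Rightarrow> [C]) = st"
    "(case ?z of None \<Rightarrow> [] | Some C \<Rightarrow> [C]) \<in> lists stack_cones"
    using located_cones[OF st] by (cases st rule: rev_cases; simp)+
  consider "?y \<in> rim ?z" | "?y \<in> region ?z - rim ?z" | "?y \<notin> region ?z" using frame(2)[OF z] by blast
  then show ?thesis
  proof cases
    case 1
    then have e: "x' = ?y" "u = (case ?z of None \<Rightarrow> [] | Some C \<Rightarrow> [C])"
      using fm by (auto simp: frame_move_def)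
    then have "butlast st @ u = st" "u \<in> lists stack_cones" using keep by auto
    then show ?thesis
      using st 1 e located_move(1)[OF st xd a] frame(2)[OF z] by (intro exI[of _ h]) auto
  next
    case 2
    let ?U = "region ?z - rim ?z"
    define C where "C = component ?U ?y"
    have e: "x' = inv_into (rep C) (emb C) ?y" "u = (case ?z of None \<Rightarrow> [] | Some C \<Rightarrow> [C]) @ [C]"
      using fm 2 by (auto simp: frame_move_def Let_def C_def)
    have C: "C \<in> cones X" using frame(5)[OF z 2] unfolding C_def .
    have "C \<subseteq> ?U" unfolding C_def using component_subset 2 by blast
    \<comment> \<open>\<open>?y\<close> has the neighbour \<open>x\<close> outside \<open>C\<close>,
      so it lies on the boundary of \<open>C\<close>, and the new state is again a rim
      vertex.\<close>
    then have "x \<notin> C" using x by blast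
    moreover have "move ?y (\<iota> a) = x" using move_inv xV a by simp
    ultimately have "\<exists>b \<in> S. move ?y b \<notin> C" using inv_in[OF a] by metis
    then have yb: "?y \<in> cone_boundary X C"
      unfolding cone_boundary_eq[OF cone_subset[OF C]] using component_self unfolding C_def by blast
    have "C \<in> stack_cones"
      unfolding stack_cones_def C_def using z x a by fastforce
    then have u: "u \<in> lists stack_cones" using e keep by simp
    have st': "butlast st @ u = st @ [C]" using e keep(1) by (metis append.assoc)
    have loc: "located (st @ [C]) (h \<circ> emb C)"
      using located.push[OF st 2 C_def] \<open>C \<in> stack_cones\<close> by blast
    have bsub: "cone_boundary X (rep C) \<subseteq> rep C" by (auto simp: cone_boundary_def)
    obtain y' where y': "y' \<in> cone_boundary X (rep C)" "?y = emb C y'" using yb emb(2)[OF C] by blast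
    have "x' = y'"
      unfolding e(1) y'(2) using bsub y'(1) by (intro inv_into_f_f bij_betw_imp_inj_on[OF emb(1)[OF C]]) blast
    then have "x' \<in> rim (Some C)" "(h \<circ> emb C) x' = move (h x) a"
      using y' located_move(1)[OF st xd a] 2 by (auto simp: rim_def)
    then show ?thesis using u loc st' by auto
  next
    case 3
    have "?z \<noteq> None" using 3 move_V[OF xV a] by (auto simp: region_def split: option.splits)
    then have "st \<noteq> []" by auto
    from st this obtain st0 h0 x0 C where st0: "st = st0 @ [C]" "h = h0 \<circ> emb C" "located st0 h0"
      "x0 \<in> region (stack_top st0) - rim (stack_top st0)"
      "C = component (region (stack_top st0) - rim (stack_top st0)) x0"
      by cases blast+
    let ?U = "region (stack_top st0) - rim (stack_top st0)"
    have z0: "stack_top st0 \<in> frames" using located_frame st0 by blast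
    have C: "C \<in> cones X" using frame(5)[OF z0] st0 by blast
    have zC: "?z = Some C" using st0 by simp
    have nr: "?y \<notin> rim ?z" using 3 frame(2)[OF z] by blast
    let ?e = "emb C x"
    have e: "x' = move ?e a" "u = []"
      using fm 3 zC nr by (auto simp: frame_move_def Let_def)
    have xr: "x \<in> rep C" "?y \<notin> rep C" using xd 3 zC by (auto simp: region_def)
    have eC: "?e \<in> C" using emb(1)[OF C] xr by (auto simp: bij_betw_def)
    have sub: "C \<subseteq> ?U" using component_subset st0 by blast
    \<comment> \<open>If the image stayed in \<open>C\<close>, the isomorphism would pull the edge
      back to one from \<open>x\<close> inside \<open>rep C\<close>, but the edge labelled
      \<open>a\<close> leaves \<open>rep C\<close>.\<close>
    have out: "move ?e a \<notin> C"
    proof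
      assume "move ?e a \<in> C"
      then obtain y' where "y' \<in> rep C" "emb C y' = move ?e a"
        using emb(1)[OF C] unfolding bij_betw_def by (metis imageE)
      then show False using emb(3)[OF C xr(1) _ a, of y'] xr(2) by simp
    qed
    \<comment> \<open>In the frame below, \<open>?e\<close> is off the rim, so the step stays in the
      region; leaving the component \<open>C\<close> nevertheless, it can only reach the rim. Thus
      one pop is enough.\<close>
    have md: "move ?e a \<in> region (stack_top st0)" using frame(4)[OF z0 _ a] eC sub by blast
    have "?e \<in> V" using eC cone_subset[OF C] by blast
    then have "move ?e a \<in> rim (stack_top st0)"
      using component_move[of ?e ?U x0 a] md out eC st0(4,5) a by blast
    moreover have "h0 (move ?e a) = move (h x) a"
      using located_move(1)[OF st0(3) _ a md] eC sub st0(2) by auto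
    ultimately show ?thesis using e st0 by auto
  qed
qed

section \<open>The deterministic automaton of a graph\<close>

text \<open>The bottom frame is the empty stack, so a separate start state first removes the start
  symbol by a silent move. All other states only read letters, which gives determinism.
  \<open>frame_move\<close> yields arbitrary values on configurations that never arise; the
  intersection discards these, and on located stacks it removes nothing.\<close>

definition cone_pda :: "'b set \<Rightarrow> ('b \<Rightarrow> 'a) \<Rightarrow> ('v option, 'b, 'v set) pda" where
  "cone_pda A \<eta> =
     \<lparr> pda_states = insert None (Some ` rims), pda_alphabet = A,
       pda_stack_symbols = insert {} stack_cones,
       pda_trans = (\<lambda>p b z.
         (case (p, b) of
            (None, None) \<Rightarrow> {(Some root, [])}
          | (Some x, Some b) \<Rightarrow> {map_prod Some id (frame_move z x (\<eta> b))}
          | _ \<Rightarrow> {}) \<inter> (insert None (Some ` rims) \<times> lists (insert {} stack_cones))),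
       pda_start = None, pda_final = {Some root}, pda_start_symbol = {} \<rparr>"

lemma rim_rims: "z \<in> frames \<Longrightarrow> rim z \<subseteq> rims"
  unfolding rims_def by blast

lemma root_rims: "root \<in> rims"
  using rim_rims[of None] by (auto simp: rim_def)

lemma cone_pda_deterministic:
  assumes "context_free_graph \<iota> X" "finite A"
  shows "deterministic_pda (cone_pda A \<eta>)"
proof -
  let ?M = "cone_pda A \<eta>"
  have card: "finite (pda_trans ?M p b z)" for p b z
    unfolding cone_pda_def by (auto split: option.splits)
  have "pda ?M"
    unfolding pda_def
    using finite_rims[OF assms(1)] finite_stack_cones[OF assms(1)] assms(2) card root_rims
    by (auto simp: cone_pda_def)
  moreover have "card (pda_trans ?M p (Some b) z) + card (pda_trans ?M p None z) \<le> 1" for p b z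
  proof (cases p)
    case None
    have "card (pda_trans ?M p None z) \<le> card {(Some root, [] :: 'v set list)}"
      by (rule card_mono) (auto simp: cone_pda_def None)
    then show ?thesis by (simp add: cone_pda_def None)
  next
    case (Some x)
    have "card (pda_trans ?M p (Some b) z) \<le> card {map_prod Some id (frame_move z x (\<eta> b))}"
      by (rule card_mono) (auto simp: cone_pda_def Some)
    then show ?thesis by (simp add: cone_pda_def Some)
  qed
  ultimately show ?thesis unfolding deterministic_pda_def by blast
qed

lemma cone_pda_step:
  assumes "located st h" "x \<in> rim (stack_top st)" "\<eta> b \<in> S" "frame_move (stack_top st) x (\<eta> b) = (x', u)"
  shows "pda_step (cone_pda A \<eta>) (Some x, b # w, st) c \<longleftrightarrow> c = (Some x', w, butlast st @ u)"
proof -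
  obtain h' where h': "located (butlast st @ u) h'" "x' \<in> rim (stack_top (butlast st @ u))"
    and u: "u \<in> lists stack_cones"
    using frame_move_located[OF assms] by blast
  have "x' \<in> rims" using rim_rims[OF located_frame[OF h'(1)]] h'(2) by blast
  then have tr: "pda_trans (cone_pda A \<eta>) (Some x) (Some b) (stack_top st) = {(Some x', u)}"
    using u assms(4) by (auto simp: cone_pda_def)
  have "pda_trans (cone_pda A \<eta>) (Some x) None (stack_top st) = {}" by (simp add: cone_pda_def)
  then show ?thesis using tr by (auto elim!: pda_step.cases intro: pda_step.read)
qed

lemma cone_pda_run:
  assumes "located st h" "x \<in> rim (stack_top st)" "\<eta> \<in> A \<rightarrow> S" "w \<in> lists A"
  shows "(pda_step (cone_pda A \<eta>))\<^sup>*\<^sup>* (Some x, w, st) (Some root, [], []) \<longleftrightarrow> moves (h x) (map \<eta> w) = root"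
  using assms
proof (induction w arbitrary: st h x)
  case Nil
  \<comment> \<open>With the input used up only silent moves could follow, and a vertex state has
    none.\<close>
  have no: "\<not> pda_step (cone_pda A \<eta>) (Some x, [], st) c" for c
    by (auto elim!: pda_step.cases simp: cone_pda_def)
  have "(pda_step (cone_pda A \<eta>))\<^sup>*\<^sup>* (Some x, [], st) (Some root, [], []) \<longleftrightarrow> x = root \<and> st = []"
    using no by (auto elim: converse_rtranclpE)
  also have "\<dots> \<longleftrightarrow> h x = root"
  proof (cases "st = []")
    case True
    then have "h = id" "x = root" using Nil by (auto simp: rim_def)
    then show ?thesis using True by simp
  next
    case False
    then show ?thesis using located_move(2)[OF Nil(1)] Nil(2) frame(2)[OF located_frame[OF Nil(1)]] by blast
  qed
  finally show ?case by simp
next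
  case (Cons b w)
  have b: "\<eta> b \<in> S" using Cons.prems by auto
  obtain x' u where fm: "frame_move (stack_top st) x (\<eta> b) = (x', u)" by fastforce
  obtain h' where h': "located (butlast st @ u) h'" "x' \<in> rim (stack_top (butlast st @ u))"
    and e: "h' x' = move (h x) (\<eta> b)"
    using frame_move_located[OF Cons.prems(1,2) b fm] by blast
  have "(pda_step (cone_pda A \<eta>))\<^sup>*\<^sup>* (Some x, b # w, st) (Some root, [], []) \<longleftrightarrow>
      (pda_step (cone_pda A \<eta>))\<^sup>*\<^sup>* (Some x', w, butlast st @ u) (Some root, [], [])"
    using cone_pda_step[of st h x \<eta> b x' u A w, OF Cons.prems(1,2) b fm]
    by (auto elim: converse_rtranclpE intro: converse_rtranclp_into_rtranclp)
  also have "\<dots> \<longleftrightarrow> moves (h' x') (map \<eta> w) = root"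
    using Cons.IH[OF h' Cons.prems(3)] Cons.prems(4) by simp
  finally show ?case using e by simp
qed

text \<open>Mapping \<open>A\<close> letter by letter into the symmetric alphabet \<open>S\<close>
  admits alphabets without inverses, as needed for presentations that are not symmetric.\<close>

theorem context_free_graph_language:
  assumes "context_free_graph \<iota> X" "finite A" "\<eta> \<in> A \<rightarrow> S"
  shows "deterministic_context_free_language A {w \<in> lists A. moves root (map \<eta> w) = root}"
proof -
  let ?M = "cone_pda A \<eta>"
  have tr: "pda_trans ?M None None z = {(Some root, [])}" "pda_trans ?M None (Some b) z = {}" for b z
    using root_rims by (auto simp: cone_pda_def)
  have step: "pda_step ?M (None, w, [{}]) c \<longleftrightarrow> c = (Some root, w, [])" for w c
  proof
    assume "pda_step ?M (None, w, [{}]) c"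
    then show "c = (Some root, w, [])" by cases (auto simp: tr)
  next
    assume "c = (Some root, w, [])"
    then show "pda_step ?M (None, w, [{}]) c"
      using pda_step.silent[of "Some root" "[]" ?M None "[{}]" w] by (simp add: tr)
  qed
  have "(\<exists>q \<in> pda_final ?M. (pda_step ?M)\<^sup>*\<^sup>* (pda_start ?M, w, [pda_start_symbol ?M]) (q, [], [])) \<longleftrightarrow>
      moves root (map \<eta> w) = root" if w: "w \<in> lists A" for w
  proof -
    have "(\<exists>q \<in> pda_final ?M. (pda_step ?M)\<^sup>*\<^sup>* (pda_start ?M, w, [pda_start_symbol ?M]) (q, [], [])) \<longleftrightarrow>
        (pda_step ?M)\<^sup>*\<^sup>* (None, w, [{}]) (Some root, [], [])"
      by (simp add: cone_pda_def)
    also have "\<dots> \<longleftrightarrow> (pda_step ?M)\<^sup>*\<^sup>* (Some root, w, []) (Some root, [], [])"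
      using step[of w] by (auto elim: converse_rtranclpE intro: converse_rtranclp_into_rtranclp)
    also have "\<dots> \<longleftrightarrow> moves root (map \<eta> w) = root"
      using cone_pda_run[OF located.bottom, of root \<eta> A w] assms(3) w by (simp add: rim_def)
    finally show ?thesis .
  qed
  then have "pda_language ?M = {w \<in> lists A. moves root (map \<eta> w) = root}"
    unfolding pda_language_def by (auto simp: cone_pda_def)
  moreover have "pda_alphabet ?M = A" by (simp add: cone_pda_def)
  ultimately show ?thesis
    using deterministic_pda_language[OF cone_pda_deterministic[OF assms(1,2), of \<eta>]] by simp
qed

end

section \<open>Schreier graphs\<close>

context group
begin

section \<open>Words acting on cosets\<close>

lemma word_value_simps [simp]:
  "word_value G \<psi> [] = \<one>" "word_value G \<psi> (a # w) = \<psi> a \<otimes> word_value G \<psi> w"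
  by (simp_all add: word_value_def)

lemma word_value_closed: "\<psi> \<in> S \<rightarrow> carrier G \<Longrightarrow> w \<in> lists S \<Longrightarrow> word_value G \<psi> w \<in> carrier G"
  by (induction w) auto

lemma word_value_append:
  "\<psi> \<in> S \<rightarrow> carrier G \<Longrightarrow> v \<in> lists S \<Longrightarrow> w \<in> lists S \<Longrightarrow>
   word_value G \<psi> (v @ w) = word_value G \<psi> v \<otimes> word_value G \<psi> w"
proof (induction v)
  case (Cons a v)
  then have "\<psi> a \<in> carrier G" by auto
  moreover have "v \<in> lists S" using Cons.prems by simp
  ultimately show ?case using Cons word_value_closed[of \<psi> S] by (simp add: m_assoc)
qed (simp add: word_value_closed)

lemma mult_inv_cancel: "x \<in> carrier G \<Longrightarrow> y \<in> carrier G \<Longrightarrow> x \<otimes> (inv x \<otimes> y) = y"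
  by (simp add: m_assoc[symmetric])

lemma coset_moves:
  assumes "\<psi> \<in> S \<rightarrow> carrier G" "x \<subseteq> carrier G" "w \<in> lists S"
  shows "foldl (\<lambda>x a. x #> \<psi> a) x w = x #> word_value G \<psi> w"
  using assms(2,3)
proof (induction w arbitrary: x)
  case Nil
  then show ?case by (simp add: coset_mult_one)
next
  case (Cons a w)
  have "\<psi> a \<in> carrier G" using assms(1) Cons.prems by auto
  then show ?case
    using Cons r_coset_subset_G[of x "\<psi> a"] word_value_closed[OF assms(1)] by (simp add: coset_mult_assoc)
qed

lemma schreier_complete:
  assumes H: "subgroup H G" and \<psi>: "symmetric_presentation G S \<iota> \<psi>"
  shows "complete_symmetric_graph (rcosets H) S \<iota> (\<lambda>x a. x #> \<psi> a) H"
proof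
  have pres: "finite S" "\<psi> \<in> S \<rightarrow> carrier G" "word_value G \<psi> ` lists S = carrier G"
    using \<psi> unfolding symmetric_presentation_def semigroup_presentation_def by auto
  have HG: "H \<subseteq> carrier G" using H by (rule subgroup.subset)
  show "finite S" by fact
  show "fixpoint_free_involution S \<iota>" using \<psi> unfolding symmetric_presentation_def by blast
  have H1: "H #> \<one> = H" using HG by (rule coset_mult_one)
  then show "H \<in> rcosets H" unfolding RCOSETS_def by (auto intro!: bexI[of _ \<one>])
  fix x assume "x \<in> rcosets H"
  then obtain g where g: "g \<in> carrier G" "x = H #> g" unfolding RCOSETS_def by blast
  show "\<exists>w \<in> lists S. foldl (\<lambda>x a. x #> \<psi> a) H w = x"
  proof -
    obtain w where w: "w \<in> lists S" "word_value G \<psi> w = g" using pres(3) g(1) by (metis imageE)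
    then show ?thesis using coset_moves[OF pres(2) HG w(1)] g by auto
  qed
  fix a assume a: "a \<in> S"
  have pa: "\<psi> a \<in> carrier G" using pres a by auto
  have ia: "\<psi> (\<iota> a) = inv \<psi> a" using \<psi> a unfolding symmetric_presentation_def by blast
  show "x #> \<psi> a \<in> rcosets H"
    unfolding g(2) coset_mult_assoc[OF HG g(1) pa] RCOSETS_def using g pa by auto
  have "x #> \<psi> a #> \<psi> (\<iota> a) = H #> (g \<otimes> \<psi> a \<otimes> inv \<psi> a)"
    unfolding g(2) ia using HG g pa by (simp add: coset_mult_assoc)
  also have "\<dots> = x" using g pa by (simp add: m_assoc)
  finally show "x #> \<psi> a #> \<psi> (\<iota> a) = x" .
qed

lemma schreier_graph_eq:
  assumes H: "subgroup H G" and \<psi>: "symmetric_presentation G S \<iota> \<psi>"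
  shows "complete_symmetric_graph.X (rcosets H) S (\<lambda>x a. x #> \<psi> a) H = schreier_graph G H S \<psi>"
proof -
  interpret Y: complete_symmetric_graph "rcosets H" S \<iota> "\<lambda>x a. x #> \<psi> a" H
    using schreier_complete[OF assms] .
  have \<psi>': "\<psi> \<in> S \<rightarrow> carrier G"
    using \<psi> unfolding symmetric_presentation_def semigroup_presentation_def by auto
  have HG: "H \<subseteq> carrier G" using H by (rule subgroup.subset)
  have e: "(H #> g) #> \<psi> a = H #> (g \<otimes> \<psi> a)" if "g \<in> carrier G" "a \<in> S" for g a
    using coset_mult_assoc[OF HG that(1)] \<psi>' that(2) by auto
  have "{(x, a, x #> \<psi> a) | x a. x \<in> rcosets H \<and> a \<in> S} =
      {(H #> g, a, H #> (g \<otimes> \<psi> a)) | g a. g \<in> carrier G \<and> a \<in> S}"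
  proof (intro equalityI subsetI)
    fix t assume "t \<in> {(x, a, x #> \<psi> a) | x a. x \<in> rcosets H \<and> a \<in> S}"
    then obtain g a where "g \<in> carrier G" "a \<in> S" "t = (H #> g, a, (H #> g) #> \<psi> a)"
      unfolding RCOSETS_def by auto
    then show "t \<in> {(H #> g, a, H #> (g \<otimes> \<psi> a)) | g a. g \<in> carrier G \<and> a \<in> S}" using e by auto
  next
    fix t assume "t \<in> {(H #> g, a, H #> (g \<otimes> \<psi> a)) | g a. g \<in> carrier G \<and> a \<in> S}"
    then obtain g a where ga: "g \<in> carrier G" "a \<in> S" "t = (H #> g, a, (H #> g) #> \<psi> a)" using e by auto
    moreover have "H #> g \<in> rcosets H" using ga unfolding RCOSETS_def by blast
    ultimately show "t \<in> {(x, a, x #> \<psi> a) | x a. x \<in> rcosets H \<and> a \<in> S}" by blast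
  qed
  then show ?thesis unfolding Y.X_def schreier_graph_def by simp
qed

section \<open>Conjugate subgroups\<close>

lemma conjugate_iff:
  assumes K: "subgroup K G" and g: "g \<in> carrier G"
  shows "h \<in> inv g <# K #> g \<longleftrightarrow> h \<in> carrier G \<and> g \<otimes> h \<otimes> inv g \<in> K"
proof
  have KG: "k \<in> K \<Longrightarrow> k \<in> carrier G" for k using subgroup.subset[OF K] by blast
  assume "h \<in> inv g <# K #> g"
  then obtain k where k: "k \<in> K" "h = inv g \<otimes> k \<otimes> g" unfolding l_coset_def r_coset_def by auto
  then have "g \<otimes> h \<otimes> inv g = k" using g KG by (simp add: m_assoc mult_inv_cancel)
  then show "h \<in> carrier G \<and> g \<otimes> h \<otimes> inv g \<in> K" using k g KG by auto
next
  assume h: "h \<in> carrier G \<and> g \<otimes> h \<otimes> inv g \<in> K"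
  then have "h = inv g \<otimes> (g \<otimes> h \<otimes> inv g) \<otimes> g" using g by (simp add: m_assoc inv_solve_left)
  then show "h \<in> inv g <# K #> g" using h unfolding l_coset_def r_coset_def by auto
qed

lemma subgroup_conjugate:
  assumes K: "subgroup K G" and g: "g \<in> carrier G"
  shows "subgroup (inv g <# K #> g) G"
proof
  note [simp] = conjugate_iff[OF assms]
  show "inv g <# K #> g \<subseteq> carrier G" by auto
  show "\<one> \<in> inv g <# K #> g" using g subgroup.one_closed[OF K] by simp
  fix x assume x: "x \<in> inv g <# K #> g"
  have "inv (g \<otimes> x \<otimes> inv g) = g \<otimes> inv x \<otimes> inv g" using x g by (simp add: inv_mult_group m_assoc)
  then show "inv x \<in> inv g <# K #> g" using x subgroup.m_inv_closed[OF K, of "g \<otimes> x \<otimes> inv g"] by simp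
  fix y assume y: "y \<in> inv g <# K #> g"
  have "(g \<otimes> x \<otimes> inv g) \<otimes> (g \<otimes> y \<otimes> inv g) = g \<otimes> (x \<otimes> y) \<otimes> inv g"
    using x y g by (simp add: m_assoc inv_solve_left')
  then show "x \<otimes> y \<in> inv g <# K #> g" using x y subgroup.m_closed[OF K, of "g \<otimes> x \<otimes> inv g"] by fastforce
qed

text \<open>The language given for \<open>K\<close> is read as a language of loops in the Schreier
  graph of the conjugate, so no language of the conjugate has to be known beforehand.\<close>

theorem context_free_pair_graph:
  assumes cf: "context_free_pair G K" and K: "subgroup K G" and g: "g \<in> carrier G"
    and \<psi>: "symmetric_presentation G S \<iota> \<psi>"
  shows "context_free_graph \<iota> (schreier_graph G (inv g <# K #> g) S \<psi>)"
proof -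
  define H where "H = inv g <# K #> g"
  have H: "subgroup H G" unfolding H_def using subgroup_conjugate[OF K g] .
  have HG: "H \<subseteq> carrier G" using H by (rule subgroup.subset)
  interpret Y: complete_symmetric_graph "rcosets H" S \<iota> "\<lambda>x a. x #> \<psi> a" H
    using schreier_complete[OF H \<psi>] .
  have pres: "\<psi> \<in> S \<rightarrow> carrier G" "word_value G \<psi> ` lists S = carrier G"
    using \<psi> unfolding symmetric_presentation_def semigroup_presentation_def by auto
  obtain S' :: "nat set" and \<psi>' where \<psi>': "\<psi>' \<in> S' \<rightarrow> carrier G" "word_value G \<psi>' ` lists S' = carrier G"
    and L: "context_free_language S' (pair_language G K S' \<psi>')"
    using cf unfolding context_free_pair_def semigroup_presentation_def by blast
  obtain F where F: "splitting_family S' F" "pair_language G K S' \<psi>' \<in> F"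
    using context_free_splitting_family[OF L] .
  have "\<forall>a \<in> S. \<exists>w. w \<in> lists S' \<and> word_value G \<psi>' w = \<psi> a"
    using pres \<psi>'(2) by (metis Pi_iff imageE)
  then obtain \<phi> where \<phi>: "\<And>a. a \<in> S \<Longrightarrow> \<phi> a \<in> lists S' \<and> word_value G \<psi>' (\<phi> a) = \<psi> a" by metis
  have "\<forall>b \<in> S'. \<exists>w. w \<in> lists S \<and> word_value G \<psi> w = \<psi>' b"
    using pres \<psi>'(1) by (metis Pi_iff imageE)
  then obtain \<eta> where \<eta>: "\<And>b. b \<in> S' \<Longrightarrow> \<eta> b \<in> lists S \<and> word_value G \<psi> (\<eta> b) = \<psi>' b" by metis
  have VG: "x \<subseteq> carrier G" if "x \<in> rcosets H" for x
    using that HG r_coset_subset_G unfolding RCOSETS_def by auto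
  \<comment> \<open>With H = g^-1 K g this vertex is the set g^-1 K, and its stabilizer under right
    multiplication is g H g^-1 = K.\<close>
  let ?base = "H #> inv g"
  have base: "?base \<subseteq> carrier G" using HG g r_coset_subset_G by auto
  have fix_iff: "?base #> w = ?base \<longleftrightarrow> w \<in> K" if w: "w \<in> carrier G" for w
  proof -
    have "?base #> w = ?base \<longleftrightarrow> H #> (inv g \<otimes> w) = H #> inv g"
      using HG g w by (simp add: coset_mult_assoc)
    also have "\<dots> \<longleftrightarrow> H #> (inv g \<otimes> w \<otimes> inv (inv g)) = H"
      using coset_mult_inv1[of H "inv g \<otimes> w" "inv g"] coset_mult_inv2[of H "inv g \<otimes> w" "inv g"] HG g w by auto
    also have "\<dots> \<longleftrightarrow> inv g \<otimes> w \<otimes> g \<in> H"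
      using coset_join1[of H "inv g \<otimes> w \<otimes> g"] coset_join2[of "inv g \<otimes> w \<otimes> g" H] HG H g w by auto
    also have "\<dots> \<longleftrightarrow> g \<otimes> (inv g \<otimes> w \<otimes> g) \<otimes> inv g \<in> K"
      unfolding H_def conjugate_iff[OF K g] using g w by simp
    also have "g \<otimes> (inv g \<otimes> w \<otimes> g) \<otimes> inv g = w" using g w by (simp add: m_assoc mult_inv_cancel)
    finally show ?thesis .
  qed
  have "pair_language G K S' \<psi>' = {w \<in> lists S'. foldl (\<lambda>x b. x #> \<psi>' b) ?base w = ?base}"
    unfolding pair_language_def
    using coset_moves[OF \<psi>'(1) base] fix_iff[OF word_value_closed[OF \<psi>'(1)]] by blast
  then interpret translated_graph "rcosets H" S \<iota> "\<lambda>x a. x #> \<psi> a" H S' "\<lambda>x b. x #> \<psi>' b" \<phi> \<eta> ?base F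
  proof unfold_locales
    show "?base \<in> rcosets H" unfolding RCOSETS_def using g by blast
    show "foldl (\<lambda>x b. x #> \<psi>' b) x (\<phi> a) = x #> \<psi> a" if "x \<in> rcosets H" "a \<in> S" for x a
      using coset_moves[OF \<psi>'(1) VG[OF that(1)]] \<phi>[OF that(2)] by simp
    show "foldl (\<lambda>x a. x #> \<psi> a) x (\<eta> b) = x #> \<psi>' b" if "x \<in> rcosets H" "b \<in> S'" for x b
      using coset_moves[OF pres(1) VG[OF that(1)]] \<eta>[OF that(2)] by simp
  qed (use \<phi> \<eta> F in auto)
  show ?thesis
    using context_free_graph_X schreier_graph_eq[OF H \<psi>] unfolding H_def by simp
qed

section \<open>Symmetric presentations from arbitrary generators\<close>

text \<open>The letter a becomes 2a and its formal inverse is 2a + 1. Exchanging the two has no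
  fixed letter even if the value of a is its own inverse in the group.\<close>

definition doubled_map :: "(nat \<Rightarrow> 'a) \<Rightarrow> nat \<Rightarrow> 'a" where
  "doubled_map \<psi> n = (if even n then \<psi> (n div 2) else inv (\<psi> (n div 2)))"

definition doubled :: "nat set \<Rightarrow> nat set" where
  "doubled S = {n. n div 2 \<in> S}"

lemma doubled_presentation:
  assumes S: "finite S" "\<psi> \<in> S \<rightarrow> carrier G" and gen: "generate G (\<psi> ` S) = carrier G"
  shows "symmetric_presentation G (doubled S) (\<lambda>n. if even n then Suc n else n - 1) (doubled_map \<psi>)"
proof -
  let ?S = "doubled S" and ?\<psi> = "doubled_map \<psi>"
  have "?S \<subseteq> (\<lambda>a. 2 * a) ` S \<union> (\<lambda>a. Suc (2 * a)) ` S"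
  proof
    fix n assume "n \<in> ?S"
    then have "n div 2 \<in> S" "n = 2 * (n div 2) \<or> n = Suc (2 * (n div 2))" by (auto simp: doubled_def)
    then show "n \<in> (\<lambda>a. 2 * a) ` S \<union> (\<lambda>a. Suc (2 * a)) ` S" by blast
  qed
  then have fin: "finite ?S" by (rule finite_subset) (use S(1) in auto)
  have pc: "\<psi> a \<in> carrier G" if "a \<in> S" for a using S(2) that by auto
  have car: "?\<psi> \<in> ?S \<rightarrow> carrier G" by (auto simp: doubled_def doubled_map_def pc)
  have "\<exists>w \<in> lists ?S. word_value G ?\<psi> w = h" if "h \<in> generate G (\<psi> ` S)" for h
    using that
  proof (induction rule: generate.induct)
    case one
    show ?case by (rule bexI[of _ "[]"]) auto
  next
    case (incl h)
    then obtain a where "a \<in> S" "h = \<psi> a" by blast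
    then show ?case by (intro bexI[of _ "[2 * a]"]) (auto simp: doubled_def doubled_map_def pc)
  next
    case (inv h)
    then obtain a where "a \<in> S" "h = \<psi> a" by blast
    then show ?case by (intro bexI[of _ "[Suc (2 * a)]"]) (auto simp: doubled_def doubled_map_def pc)
  next
    case (eng h1 h2)
    then obtain v w where "v \<in> lists ?S" "w \<in> lists ?S" "word_value G ?\<psi> v = h1" "word_value G ?\<psi> w = h2"
      by blast
    then show ?case using word_value_append[OF car] by (intro bexI[of _ "v @ w"]) auto
  qed
  then have "word_value G ?\<psi> ` lists ?S = carrier G"
    using gen word_value_closed[OF car] by (auto simp: image_iff)
  moreover have "fixpoint_free_involution ?S (\<lambda>n. if even n then Suc n else n - 1)"
    unfolding fixpoint_free_involution_def by (auto simp: doubled_def elim!: oddE evenE)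
  moreover have "?\<psi> (if even n then Suc n else n - 1) = inv (?\<psi> n)" if "n \<in> ?S" for n
    using that by (auto simp: doubled_def doubled_map_def pc elim!: oddE evenE)
  ultimately show ?thesis
    unfolding symmetric_presentation_def semigroup_presentation_def using fin car by blast
qed

lemma semigroup_presentation_generate:
  assumes "semigroup_presentation G S \<psi>"
  shows "generate G (\<psi> ` S) = carrier G"
proof
  have \<psi>: "\<psi> \<in> S \<rightarrow> carrier G" "word_value G \<psi> ` lists S = carrier G"
    using assms unfolding semigroup_presentation_def by auto
  show "generate G (\<psi> ` S) \<subseteq> carrier G" using \<psi>(1) by (intro generate_incl) auto
  have "word_value G \<psi> w \<in> generate G (\<psi> ` S)" if "w \<in> lists S" for w
    using that
  proof (induction w)
    case (Cons a w)
    then have "\<psi> a \<in> generate G (\<psi> ` S)" "word_value G \<psi> w \<in> generate G (\<psi> ` S)"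
      using generate.incl[of "\<psi> a" "\<psi> ` S" G] by auto
    then show ?case by (simp add: generate.eng)
  qed (simp add: generate.one)
  then have "word_value G \<psi> ` lists S \<subseteq> generate G (\<psi> ` S)" by (rule image_subsetI)
  then show "carrier G \<subseteq> generate G (\<psi> ` S)" unfolding \<psi>(2) .
qed

text \<open>The hypothesis speaks of symmetric presentations only. The graph of the doubled alphabet
  is context-free, and the original words are those over its even letters.\<close>

theorem context_free_graphs_language:
  fixes S :: "nat set"
  assumes K: "subgroup K G"
    and graphs: "\<And>(S :: nat set) \<iota> \<psi>. symmetric_presentation G S \<iota> \<psi> \<Longrightarrow>
      context_free_graph \<iota> (schreier_graph G K S \<psi>)"
    and \<psi>: "semigroup_presentation G S \<psi>"
  shows "deterministic_context_free_language S (pair_language G K S \<psi>)"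
proof -
  let ?S = "doubled S" and ?\<psi> = "doubled_map \<psi>" and ?\<iota> = "\<lambda>n. if even n then Suc n else n - 1 :: nat"
  have S: "finite S" "\<psi> \<in> S \<rightarrow> carrier G" using \<psi> unfolding semigroup_presentation_def by auto
  have sym: "symmetric_presentation G ?S ?\<iota> ?\<psi>"
    using doubled_presentation[OF S semigroup_presentation_generate[OF \<psi>]] .
  interpret Y: complete_symmetric_graph "rcosets K" ?S ?\<iota> "\<lambda>x a. x #> ?\<psi> a" K
    using schreier_complete[OF K sym] .
  have KG: "K \<subseteq> carrier G" using K by (rule subgroup.subset)
  have "context_free_graph ?\<iota> Y.X" using graphs[OF sym] schreier_graph_eq[OF K sym] by simp
  then have "deterministic_context_free_language S
      {w \<in> lists S. Y.moves K (map (\<lambda>a. 2 * a) w) = K}"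
    by (rule Y.context_free_graph_language) (use S in \<open>auto simp: doubled_def\<close>)
  moreover have "Y.moves K (map (\<lambda>a. 2 * a) w) = K \<longleftrightarrow> word_value G \<psi> w \<in> K" if w: "w \<in> lists S" for w
  proof -
    have "Y.moves K (map (\<lambda>a. 2 * a) w) = K #> word_value G \<psi> w"
      using coset_moves[OF S(2) KG w] by (simp add: foldl_map doubled_map_def)
    then show ?thesis
      using coset_join1[of K "word_value G \<psi> w"] coset_join2[of "word_value G \<psi> w" K]
        word_value_closed[OF S(2) w] K KG by auto
  qed
  ultimately show ?thesis unfolding pair_language_def by (simp cong: conj_cong)
qed

lemma deterministic_context_free_pair:
  fixes S :: "nat set"
  assumes "semigroup_presentation G S \<psi>" "deterministic_context_free_language S (pair_language G K S \<psi>)"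
  shows "context_free_pair G K"
  using assms
  unfolding context_free_pair_def context_free_language_def deterministic_context_free_language_def
    deterministic_pda_def by blast

end

text \<open>This is where finite generation is used: without some presentation over numbers, the
  condition on all Schreier graphs would be vacuous and could not give a context-free pair.\<close>

lemma finitely_generated_presentation:
  assumes "finitely_generated_group G"
  obtains S :: "nat set" and \<psi> where "semigroup_presentation G S \<psi>"
proof -
  interpret group G using assms unfolding finitely_generated_group_def by blast
  obtain A where A: "finite A" "A \<subseteq> carrier G" "generate G A = carrier G"
    using assms unfolding finitely_generated_group_def by blast
  obtain e where e: "bij_betw e {0..<card A} A" using ex_bij_betw_nat_finite[OF A(1)] by blast
  then have "e ` {0..<card A} = A" by (rule bij_betw_imp_surj_on)
  then have "symmetric_presentation G (doubled {0..<card A}) (\<lambda>n. if even n then Suc n else n - 1) (doubled_map e)"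
    using A by (intro doubled_presentation) auto
  then show thesis using that unfolding symmetric_presentation_def by blast
qed

theorem corollary4p10:
  fixes G :: "('g, 'm) monoid_scheme" and K :: "'g set"
  assumes "finitely_generated_group G" and "subgroup K G"
  shows "(context_free_pair G K \<longleftrightarrow>
            (\<forall>(S :: nat set) \<iota> \<psi>. symmetric_presentation G S \<iota> \<psi> \<longrightarrow>
               context_free_graph \<iota> (schreier_graph G K S \<psi>)))
       \<and> (context_free_pair G K \<longrightarrow>
            (\<forall>(S :: nat set) \<psi>. semigroup_presentation G S \<psi> \<longrightarrow>
               deterministic_context_free_language S (pair_language G K S \<psi>)))
       \<and> (context_free_pair G K \<longrightarrow>
            (\<forall>g \<in> carrier G. context_free_pair G (inv\<^bsub>G\<^esub> g <#\<^bsub>G\<^esub> K #>\<^bsub>G\<^esub> g)))"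
proof -
  interpret group G using assms(1) unfolding finitely_generated_group_def by blast
  note K = assms(2)
  obtain S0 :: "nat set" and \<psi>0 where pres: "semigroup_presentation G S0 \<psi>0"
    using finitely_generated_presentation[OF assms(1)] .
  \<comment> \<open>The forward direction of (a) is conjugation by the unit.\<close>
  have "inv\<^bsub>G\<^esub> \<one>\<^bsub>G\<^esub> <#\<^bsub>G\<^esub> K #>\<^bsub>G\<^esub> \<one>\<^bsub>G\<^esub> = K"
    using conjugate_iff[OF K one_closed] subgroup.subset[OF K] by auto
  then have graph: "context_free_graph \<iota> (schreier_graph G K S \<psi>)"
    if "context_free_pair G K" "symmetric_presentation G S \<iota> \<psi>" for S :: "nat set" and \<iota> \<psi>
    using context_free_pair_graph[OF that(1) K one_closed that(2)] by simp
  \<comment> \<open>Stated for an arbitrary subgroup because it is applied to \<open>K\<close> for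
    (a) and to its conjugates for (b).\<close>
  have pair: "context_free_pair G K'"
    if "subgroup K' G" "\<And>(S :: nat set) \<iota> \<psi>. symmetric_presentation G S \<iota> \<psi> \<Longrightarrow>
      context_free_graph \<iota> (schreier_graph G K' S \<psi>)" for K'
    using deterministic_context_free_pair[OF pres context_free_graphs_language[OF that pres]] .
  show ?thesis
    using graph pair[OF K] context_free_graphs_language[OF K]
      pair[OF subgroup_conjugate[OF K]] context_free_pair_graph[OF _ K] by blast
qed

end
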